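(* Let $m,n\geq 1$ be integers with $m+n\leq 5$, let $N=mn$ be the number of edges of the complete bipartite graph $K_{m,n}$, and let $\mathbb{K}$ be a field of characteristic zero. Then the algebra $A_{M(K_{m,n})}=\mathbb{K}[x_1,\ldots,x_N]/\mathrm{Ann}(F_{K_{m,n}})$ has the strong Lefschetz property, and $x_{1}+\cdots+x_{N}$ is a strong Lefschetz element.
   Context: For a connected graph $\Gamma$ with $N$ edges labelled $1,\dots,N$, assign the variable $x_e$ to edge $e$; the Kirchhoff polynomial is $F_\Gamma=\sum_{T}\prod_{e\in E(T)}x_e$, the sum over spanning trees $T$ of $\Gamma$. For a homogeneous $F\in\mathbb{K}[x_1,\ldots,x_N]$, $\mathrm{Ann}(F)=\{P\in\mathbb{K}[x_1,\ldots,x_N]: P(\partial/\partial x_1,\ldots,\partial/\partial x_N)F=0\}$, a homogeneous ideal; $A_{M(\Gamma)}=\mathbb{K}[x_1,\ldots,x_N]/\mathrm{Ann}(F_\Gamma)$ is a graded Artinian Gorenstein algebra. A graded Artinian algebra $A=\bigoplus_{k=0}^sA_k$ with $A_s\neq 0$ has the strong Lefschetz property if there is $L\in A_1$ such that multiplication by $L^{s-2k}$ is a bijection $A_k\to A_{s-k}$ for all $k\leq s/2$; such an $L$ is a strong Lefschetz element. *)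

theory Defs
  imports "HOL-Library.Poly_Mapping" "HOL-Algebra.QuotRing"
begin

text \<open>Undirected graphs with labelled edges: \<open>ends G e\<close> is the set of end points of the edge
  labelled \<open>e\<close>. Loops and parallel edges are allowed.\<close>

record ('v, 'e) ugraph =
  verts :: "'v set"
  edges :: "'e set"
  ends :: "'e \<Rightarrow> 'v set"

definition adj_by :: "('v, 'e) ugraph \<Rightarrow> 'e set \<Rightarrow> ('v \<times> 'v) set" where
  "adj_by G T = {(u, v). \<exists>e\<in>T. ends G e = {u, v}}"

definition connects :: "('v, 'e) ugraph \<Rightarrow> 'e set \<Rightarrow> bool" where
  "connects G T \<longleftrightarrow> (\<forall>u\<in>verts G. \<forall>v\<in>verts G. (u, v) \<in> (adj_by G T)\<^sup>*)"

text \<open>The cycle passes through the vertices \<open>vs\<close> and the edges \<open>es\<close>. Distinctness of \<open>es\<close> rules out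
  going back and forth along one edge; loops and pairs of parallel edges are cycles.\<close>

definition is_cycle :: "('v, 'e) ugraph \<Rightarrow> 'v list \<Rightarrow> 'e list \<Rightarrow> bool" where
  "is_cycle G vs es \<longleftrightarrow>
     vs \<noteq> [] \<and> length es = length vs \<and> distinct vs \<and> distinct es \<and>
     (\<forall>i<length vs. ends G (es ! i) = {vs ! i, vs ! (Suc i mod length vs)})"

definition acyclic_edges :: "('v, 'e) ugraph \<Rightarrow> 'e set \<Rightarrow> bool" where
  "acyclic_edges G T \<longleftrightarrow> (\<nexists>vs es. set es \<subseteq> T \<and> is_cycle G vs es)"

text \<open>A spanning tree is identified with its set of edges.\<close>

definition spanning_trees :: "('v, 'e) ugraph \<Rightarrow> 'e set set" where
  "spanning_trees G = {T. T \<subseteq> edges G \<and> connects G T \<and> acyclic_edges G T}"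

definition bipartite_edge_set :: "nat \<Rightarrow> nat \<Rightarrow> (nat + nat) set set" where
  "bipartite_edge_set m n = {{Inl i, Inr j} | i j. i < m \<and> j < n}"

text \<open>\<open>K\<^sub>m\<^sub>,\<^sub>n\<close> with its edges labelled \<open>1, \<dots>, m n\<close> by \<open>lab\<close>, which is meant to be a bijection from
  \<open>{1..m * n}\<close> onto \<open>bipartite_edge_set m n\<close>.\<close>

definition complete_bipartite :: "nat \<Rightarrow> nat \<Rightarrow> (nat \<Rightarrow> (nat + nat) set) \<Rightarrow> (nat + nat, nat) ugraph" where
  "complete_bipartite m n lab = \<lparr>verts = {..<m} <+> {..<n}, edges = {1..m * n}, ends = lab\<rparr>"


type_synonym ('x, 'k) mpoly = "('x \<Rightarrow>\<^sub>0 nat) \<Rightarrow>\<^sub>0 'k"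

definition mvar :: "'x \<Rightarrow> ('x, 'k::comm_ring_1) mpoly" where
  "mvar x = Poly_Mapping.single (Poly_Mapping.single x 1) 1"

definition mvars :: "('x, 'k::zero) mpoly \<Rightarrow> 'x set" where
  "mvars p = (\<Union>a\<in>Poly_Mapping.keys p. Poly_Mapping.keys a)"

definition mdeg :: "('x \<Rightarrow>\<^sub>0 nat) \<Rightarrow> nat" where
  "mdeg a = (\<Sum>x\<in>Poly_Mapping.keys a. Poly_Mapping.lookup a x)"

definition homogeneous :: "nat \<Rightarrow> ('x, 'k::zero) mpoly \<Rightarrow> bool" where
  "homogeneous k p \<longleftrightarrow> (\<forall>a\<in>Poly_Mapping.keys p. mdeg a = k)"

definition poly_ring :: "'x set \<Rightarrow> ('x, 'k::comm_ring_1) mpoly ring" where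
  "poly_ring X = \<lparr>carrier = {p. mvars p \<subseteq> X}, mult = (*), one = 1, zero = 0, add = (+)\<rparr>"

definition partial :: "'x \<Rightarrow> ('x, 'k::comm_ring_1) mpoly \<Rightarrow> ('x, 'k) mpoly" where
  "partial x p = (\<Sum>a\<in>Poly_Mapping.keys p.
     Poly_Mapping.single (a - Poly_Mapping.single x 1)
       (of_nat (Poly_Mapping.lookup a x) * Poly_Mapping.lookup p a))"

text \<open>The operator obtained from the monomial with exponent vector \<open>a\<close>; the order in which the fold
  composes the partial derivatives is irrelevant by \<open>partial_commute\<close> below.\<close>

definition monom_diff :: "('x \<Rightarrow>\<^sub>0 nat) \<Rightarrow> ('x, 'k::comm_ring_1) mpoly \<Rightarrow> ('x, 'k) mpoly" where
  "monom_diff a p =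
     Finite_Set.fold (\<lambda>x. partial x ^^ Poly_Mapping.lookup a x) p (Poly_Mapping.keys a)"

definition poly_diff :: "('x, 'k::comm_ring_1) mpoly \<Rightarrow> ('x, 'k) mpoly \<Rightarrow> ('x, 'k) mpoly" where
  "poly_diff P p = (\<Sum>a\<in>Poly_Mapping.keys P.
     Poly_Mapping.single 0 (Poly_Mapping.lookup P a) * monom_diff a p)"

definition Ann :: "'x set \<Rightarrow> ('x, 'k::comm_ring_1) mpoly \<Rightarrow> ('x, 'k) mpoly set" where
  "Ann X p = {P \<in> carrier (poly_ring X). poly_diff P p = 0}"

lemma lookup_partial:
  "Poly_Mapping.lookup (partial x p) b =
     of_nat (Suc (Poly_Mapping.lookup b x)) *
     Poly_Mapping.lookup p (b + Poly_Mapping.single x 1)"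
proof -
  let ?s = "Poly_Mapping.single x (1::nat)"
  have eq: "a - ?s = b \<longleftrightarrow> a = b + ?s" if "Poly_Mapping.lookup a x \<noteq> 0" for a
  proof
    assume "a - ?s = b"
    then show "a = b + ?s"
      using that
      by (intro poly_mapping_eqI)
        (auto simp: lookup_add lookup_minus lookup_single when_def)
  qed simp
  have "Poly_Mapping.lookup (partial x p) b =
      (\<Sum>a\<in>Poly_Mapping.keys p. (of_nat (Poly_Mapping.lookup a x) * Poly_Mapping.lookup p a
         when a - ?s = b))"
    by (simp add: partial_def lookup_sum lookup_single)
  also have "\<dots> = (\<Sum>a\<in>Poly_Mapping.keys p.
      if a = b + ?s then of_nat (Poly_Mapping.lookup a x) * Poly_Mapping.lookup p a else 0)"
  proof (rule sum.cong[OF refl])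
    fix a
    show "(of_nat (Poly_Mapping.lookup a x) * Poly_Mapping.lookup p a when a - ?s = b) =
        (if a = b + ?s then of_nat (Poly_Mapping.lookup a x) * Poly_Mapping.lookup p a else 0)"
    proof (cases "Poly_Mapping.lookup a x = 0")
      case False
      then show ?thesis using eq[of a] by (simp add: when_def)
    qed (auto simp: when_def lookup_add lookup_single)
  qed
  also have "\<dots> = of_nat (Suc (Poly_Mapping.lookup b x)) * Poly_Mapping.lookup p (b + ?s)"
    by (auto simp: lookup_add lookup_single in_keys_iff)
  finally show ?thesis .
qed

lemma partial_commute: "partial x (partial y p) = partial y (partial x p)"
proof (rule poly_mapping_eqI)
  fix b
  let ?s = "\<lambda>x. Poly_Mapping.single x (1::nat)"
  have "b + ?s x + ?s y = b + ?s y + ?s x"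
    by (simp only: ac_simps)
  then show "Poly_Mapping.lookup (partial x (partial y p)) b =
      Poly_Mapping.lookup (partial y (partial x p)) b"
    by (cases "x = y")
      (simp_all add: lookup_partial lookup_add lookup_single when_def mult.left_commute)
qed


definition kirchhoff :: "('v, 'e) ugraph \<Rightarrow> ('e, 'k::comm_ring_1) mpoly" where
  "kirchhoff G = (\<Sum>T\<in>spanning_trees G. \<Prod>e\<in>T. mvar e)"

definition graph_class :: "('v, 'e) ugraph \<Rightarrow> ('e, 'k::comm_ring_1) mpoly \<Rightarrow> ('e, 'k) mpoly set" where
  "graph_class G p = Ann (edges G) (kirchhoff G) +>\<^bsub>poly_ring (edges G)\<^esub> p"

definition graph_algebra :: "('v, 'e) ugraph \<Rightarrow> ('e, 'k::comm_ring_1) mpoly set ring" where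
  "graph_algebra G = poly_ring (edges G) Quot Ann (edges G) (kirchhoff G)"

definition graph_grading :: "('v, 'e) ugraph \<Rightarrow> nat \<Rightarrow> ('e, 'k::comm_ring_1) mpoly set set" where
  "graph_grading G k = graph_class G ` {p \<in> carrier (poly_ring (edges G)). homogeneous k p}"

text \<open>Here \<open>gr k\<close> is the degree \<open>k\<close> component of the graded algebra \<open>A\<close>, and \<open>s\<close> is its top degree.\<close>

definition strong_lefschetz_element :: "('a, 'b) ring_scheme \<Rightarrow> (nat \<Rightarrow> 'a set) \<Rightarrow> 'a \<Rightarrow> bool" where
  "strong_lefschetz_element A gr L \<longleftrightarrow>
     L \<in> gr 1 \<and>
     (\<exists>s. gr s \<noteq> {\<zero>\<^bsub>A\<^esub>} \<and> (\<forall>k>s. gr k = {\<zero>\<^bsub>A\<^esub>}) \<and>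
       (\<forall>k. 2 * k \<le> s \<longrightarrow>
         bij_betw (\<lambda>a. L [^]\<^bsub>A\<^esub> (s - 2 * k) \<otimes>\<^bsub>A\<^esub> a) (gr k) (gr (s - k))))"

definition strong_lefschetz_property :: "('a, 'b) ring_scheme \<Rightarrow> (nat \<Rightarrow> 'a set) \<Rightarrow> bool" where
  "strong_lefschetz_property A gr \<longleftrightarrow> (\<exists>L. strong_lefschetz_element A gr L)"

end

theory Submission
  imports Defs
begin

text \<open>
  Write \<open>F\<close> for the Kirchhoff polynomial, \<open>s\<close> for its degree (one less than the number of vertices)
  and \<open>L\<close> for the sum of the variables. Since \<open>s \<le> 4\<close>, multiplication by \<open>L\<^sup>s\<^sup>-\<^sup>2\<^sup>k\<close> is trivially bijective
  in degree \<open>k = s/2\<close>, and otherwise only \<open>k = 0\<close> and \<open>k = 1\<close> occur. For \<open>k = 0\<close> it suffices that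
  \<open>L\<^sup>s\<close> acts on \<open>F\<close> as \<open>s!\<close> times the number of spanning trees. For \<open>k = 1\<close>, applying \<open>L\<^sup>s\<^sup>-\<^sup>2 x\<^sub>e x\<^sub>f\<close>
  to \<open>F\<close> gives \<open>(s - 2)!\<close> times the number of spanning trees through \<open>e\<close> and \<open>f\<close> (and \<open>0\<close> for
  \<open>e = f\<close>), so that bijectivity follows from the invertibility of the matrix of these numbers.

  A star has one spanning tree. In \<open>K\<^sub>2\<^sub>,\<^sub>n\<close> the complements of the spanning trees are the sets of
  \<open>n - 1\<close> edges with distinct end points on the side of size \<open>n\<close>. Hence two distinct edges lie in
  \<open>2\<close> common trees for \<open>n = 2\<close>; for \<open>n = 3\<close> they lie in \<open>4\<close> or \<open>5\<close>, according to whether or not they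
  share an end point on that side.
\<close>

section \<open>Differential operators and the annihilator\<close>

lemma poly_mapping_sum_single:
  fixes p :: "'a \<Rightarrow>\<^sub>0 'b::comm_monoid_add"
  shows "(\<Sum>a\<in>Poly_Mapping.keys p. Poly_Mapping.single a (Poly_Mapping.lookup p a)) = p"
  by (intro poly_mapping_eqI)
    (auto simp: lookup_sum lookup_single when_def in_keys_iff sum.delta)

text \<open>The linear functional with prescribed values on monomials. It turns the action of an
  operator on a fixed form into a pairing that is linear in the operator.\<close>

definition lin_ext :: "('a \<Rightarrow> 'k::comm_ring_1) \<Rightarrow> ('a \<Rightarrow>\<^sub>0 'k) \<Rightarrow> 'k" where
  "lin_ext g p = (\<Sum>a\<in>Poly_Mapping.keys p. Poly_Mapping.lookup p a * g a)"

lemma lin_ext_superset: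
  assumes "finite A" "Poly_Mapping.keys p \<subseteq> A"
  shows "lin_ext g p = (\<Sum>a\<in>A. Poly_Mapping.lookup p a * g a)"
  unfolding lin_ext_def using assms
  by (intro sum.mono_neutral_left) (auto simp: in_keys_iff)

lemma lin_ext_single [simp]: "lin_ext g (Poly_Mapping.single a c) = c * g a"
  by (subst lin_ext_superset[of "{a}"]) auto

lemma lin_ext_0 [simp]: "lin_ext g 0 = 0"
  by (simp add: lin_ext_def)

lemma lin_ext_add: "lin_ext g (p + q) = lin_ext g p + lin_ext g q"
proof -
  let ?A = "Poly_Mapping.keys p \<union> Poly_Mapping.keys q"
  have "lin_ext g (p + q) = (\<Sum>a\<in>?A. Poly_Mapping.lookup (p + q) a * g a)"
    by (intro lin_ext_superset keys_add) auto
  also have "\<dots> = (\<Sum>a\<in>?A. Poly_Mapping.lookup p a * g a) + (\<Sum>a\<in>?A. Poly_Mapping.lookup q a * g a)"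
    by (simp add: lookup_add distrib_right sum.distrib)
  also have "\<dots> = lin_ext g p + lin_ext g q"
    by (simp add: lin_ext_superset[symmetric])
  finally show ?thesis .
qed

lemma lin_ext_uminus: "lin_ext g (- p) = - lin_ext g p"
  using lin_ext_add[of g p "- p"] by (simp add: eq_neg_iff_add_eq_0 add.commute)

lemma lin_ext_diff: "lin_ext g (p - q) = lin_ext g p - lin_ext g q"
  using lin_ext_add[of g p "- q"] by (simp add: lin_ext_uminus)

lemma lin_ext_sum: "lin_ext g (\<Sum>i\<in>A. p i) = (\<Sum>i\<in>A. lin_ext g (p i))"
  by (induction A rule: infinite_finite_induct) (auto simp: lin_ext_add)

lemma lin_ext_sum_fun: "lin_ext (\<lambda>a. \<Sum>i\<in>A. g i a) p = (\<Sum>i\<in>A. lin_ext (g i) p)"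
  unfolding lin_ext_def sum_distrib_left by (rule sum.swap)

text \<open>Both sides are bilinear in \<open>p\<close> and \<open>q\<close>, and on monomials
  multiplication adds exponents.\<close>

lemma lin_ext_mult:
  fixes p q :: "'a::comm_monoid_add \<Rightarrow>\<^sub>0 'k::comm_ring_1"
  shows "lin_ext g (p * q) = lin_ext (\<lambda>a. lin_ext (\<lambda>b. g (a + b)) q) p"
proof -
  have "lin_ext g (p * q) = lin_ext g ((\<Sum>a\<in>Poly_Mapping.keys p. Poly_Mapping.single a (Poly_Mapping.lookup p a))
    * (\<Sum>b\<in>Poly_Mapping.keys q. Poly_Mapping.single b (Poly_Mapping.lookup q b)))"
    by (simp only: poly_mapping_sum_single)
  also have "\<dots> = (\<Sum>a\<in>Poly_Mapping.keys p. \<Sum>b\<in>Poly_Mapping.keys q.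
      Poly_Mapping.lookup p a * Poly_Mapping.lookup q b * g (a + b))"
    by (simp add: sum_product lin_ext_sum mult_single)
  also have "\<dots> = lin_ext (\<lambda>a. lin_ext (\<lambda>b. g (a + b)) q) p"
    by (simp add: lin_ext_def sum_distrib_left mult.assoc)
  finally show ?thesis .
qed

lemma lin_ext_zero_fun: "(\<And>a. a \<in> Poly_Mapping.keys p \<Longrightarrow> g a = 0) \<Longrightarrow> lin_ext g p = 0"
  by (simp add: lin_ext_def)

section \<open>Derivatives at the origin\<close>

definition exp_fact :: "('x \<Rightarrow>\<^sub>0 nat) \<Rightarrow> nat" where
  "exp_fact a = (\<Prod>x\<in>Poly_Mapping.keys a. fact (Poly_Mapping.lookup a x))"

lemma exp_fact_superset:
  assumes "finite A" "Poly_Mapping.keys a \<subseteq> A"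
  shows "exp_fact a = (\<Prod>x\<in>A. fact (Poly_Mapping.lookup a x))"
  unfolding exp_fact_def using assms
  by (intro prod.mono_neutral_left) (auto simp: in_keys_iff)

lemma exp_fact_pos [simp]: "exp_fact a \<noteq> 0"
  by (simp add: exp_fact_def)

lemma exp_fact_add_single:
  "exp_fact (a + Poly_Mapping.single x 1) = Suc (Poly_Mapping.lookup a x) * exp_fact a"
proof -
  let ?A = "insert x (Poly_Mapping.keys a)" and ?b = "a + Poly_Mapping.single x 1"
  have "exp_fact ?b = (\<Prod>y\<in>?A. fact (Poly_Mapping.lookup ?b y))"
    by (intro exp_fact_superset) (auto dest: keys_add[THEN subsetD] split: if_splits)
  also have "\<dots> = fact (Poly_Mapping.lookup ?b x) * (\<Prod>y\<in>?A - {x}. fact (Poly_Mapping.lookup ?b y))"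
    by (intro prod.remove) auto
  also have "(\<Prod>y\<in>?A - {x}. fact (Poly_Mapping.lookup ?b y)) = (\<Prod>y\<in>?A - {x}. fact (Poly_Mapping.lookup a y))"
    by (intro prod.cong) (auto simp: lookup_add lookup_single when_def)
  also have "fact (Poly_Mapping.lookup ?b x) = Suc (Poly_Mapping.lookup a x) * fact (Poly_Mapping.lookup a x)"
    by (simp add: lookup_add)
  also have "Suc (Poly_Mapping.lookup a x) * fact (Poly_Mapping.lookup a x) *
      (\<Prod>y\<in>?A - {x}. fact (Poly_Mapping.lookup a y)) =
      Suc (Poly_Mapping.lookup a x) * (\<Prod>y\<in>?A. fact (Poly_Mapping.lookup a y))"
    by (subst (2) prod.remove[of _ x]) (auto simp: algebra_simps)
  also have "(\<Prod>y\<in>?A. fact (Poly_Mapping.lookup a y)) = exp_fact a"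
    by (intro exp_fact_superset[symmetric]) auto
  finally show ?thesis .
qed

text \<open>The value at the origin of the derivative of \<open>p\<close> of multi-index \<open>a\<close>; in this
  normalisation differentiation is a mere shift of the index.\<close>

definition deriv_at_0 :: "('x, 'k::comm_ring_1) mpoly \<Rightarrow> ('x \<Rightarrow>\<^sub>0 nat) \<Rightarrow> 'k" where
  "deriv_at_0 p a = of_nat (exp_fact a) * Poly_Mapping.lookup p a"

text \<open>Characteristic zero enters here: the factorials \<open>exp_fact a\<close> can be
  cancelled.\<close>

lemma deriv_at_0_inject:
  fixes p q :: "('x, 'k::field_char_0) mpoly"
  assumes "\<And>a. deriv_at_0 p a = deriv_at_0 q a"
  shows "p = q"
  using assms by (intro poly_mapping_eqI) (simp add: deriv_at_0_def)

lemma deriv_at_0_partial: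
  "deriv_at_0 (partial x p) b = deriv_at_0 p (Poly_Mapping.single x 1 + b)"
  by (subst add.commute)
    (simp only: deriv_at_0_def lookup_partial exp_fact_add_single of_nat_mult ac_simps)

lemma deriv_at_0_partial_funpow:
  "deriv_at_0 ((partial x ^^ n) p) b = deriv_at_0 p (Poly_Mapping.single x n + b)"
proof (induction n arbitrary: b)
  case (Suc n)
  have "Poly_Mapping.single x n + (Poly_Mapping.single x 1 + b) = Poly_Mapping.single x (Suc n) + b"
    by (simp add: single_add[symmetric] add.assoc[symmetric])
  then show ?case by (simp add: deriv_at_0_partial Suc)
qed simp

lemma deriv_at_0_monom_diff:
  fixes p :: "('x, 'k::field_char_0) mpoly"
  shows "deriv_at_0 (monom_diff a p) b = deriv_at_0 p (a + b)"
proof -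
  \<comment> \<open>The powers of partial derivatives commute because shifts of the index commute
    and the shifted values determine the polynomial.\<close>
  interpret comp_fun_commute "\<lambda>x. partial x ^^ Poly_Mapping.lookup a x :: ('x, 'k) mpoly \<Rightarrow> _"
    by standard
      (auto intro!: deriv_at_0_inject simp: fun_eq_iff deriv_at_0_partial_funpow add.left_commute)
  have "deriv_at_0 (Finite_Set.fold (\<lambda>x. partial x ^^ Poly_Mapping.lookup a x) p S) b =
      deriv_at_0 p ((\<Sum>x\<in>S. Poly_Mapping.single x (Poly_Mapping.lookup a x)) + b)"
    if "finite S" for S
    using that
    by (induction S arbitrary: b) (auto simp: deriv_at_0_partial_funpow ac_simps)
  from this[of "Poly_Mapping.keys a"] show ?thesis
    by (simp add: monom_diff_def poly_mapping_sum_single)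
qed

lemma deriv_at_0_poly_diff:
  fixes p :: "('x, 'k::field_char_0) mpoly"
  shows "deriv_at_0 (poly_diff P p) b = lin_ext (\<lambda>a. deriv_at_0 p (a + b)) P"
proof -
  have c: "Poly_Mapping.lookup (Poly_Mapping.single 0 c * q) b = c * Poly_Mapping.lookup q b"
    for c :: 'k and q :: "('x, 'k) mpoly"
    by (subst (1) poly_mapping_sum_single[of q, symmetric])
      (auto simp: sum_distrib_left mult_single lookup_sum lookup_single when_def in_keys_iff)
  show ?thesis
    by (simp add: poly_diff_def deriv_at_0_def lookup_sum c sum_distrib_left lin_ext_def
        deriv_at_0_monom_diff[unfolded deriv_at_0_def, symmetric] mult.left_commute)
qed

text \<open>A polynomial vanishes iff all its derivatives at the origin do, so annihilation becomes
  one linear condition on \<open>P\<close> for each multi-index \<open>b\<close>.\<close>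

lemma Ann_iff:
  fixes p :: "('x, 'k::field_char_0) mpoly"
  shows "P \<in> Ann X p \<longleftrightarrow> mvars P \<subseteq> X \<and> (\<forall>b. lin_ext (\<lambda>a. deriv_at_0 p (a + b)) P = 0)"
proof -
  have "poly_diff P p = 0 \<longleftrightarrow> (\<forall>b. deriv_at_0 (poly_diff P p) b = deriv_at_0 0 b)"
    using deriv_at_0_inject by metis
  then show ?thesis
    by (simp add: deriv_at_0_poly_diff Ann_def poly_ring_def) (simp add: deriv_at_0_def)
qed

section \<open>The polynomial ring in a set of variables and the annihilator ideal\<close>

lemma mvars_subset_iff:
  "mvars p \<subseteq> X \<longleftrightarrow> (\<forall>a\<in>Poly_Mapping.keys p. Poly_Mapping.keys a \<subseteq> X)"
  by (auto simp: mvars_def)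

lemma mvars_add: "mvars p \<subseteq> X \<Longrightarrow> mvars q \<subseteq> X \<Longrightarrow> mvars (p + q) \<subseteq> X"
  unfolding mvars_subset_iff using keys_add[of p q] by blast

lemma mvars_uminus: "mvars (- p) = mvars (p :: ('x, 'k::ab_group_add) mpoly)"
  by (simp add: mvars_def)

lemma mvars_mult:
  fixes p q :: "('x, 'k::comm_ring_1) mpoly"
  assumes "mvars p \<subseteq> X" "mvars q \<subseteq> X"
  shows "mvars (p * q) \<subseteq> X"
  unfolding mvars_subset_iff
proof
  fix c assume "c \<in> Poly_Mapping.keys (p * q)"
  then obtain a b where "c = a + b" "a \<in> Poly_Mapping.keys p" "b \<in> Poly_Mapping.keys q"
    using keys_mult[of p q] by blast
  then show "Poly_Mapping.keys c \<subseteq> X"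
    using assms keys_add[of a b] unfolding mvars_subset_iff by blast
qed

lemma mvars_one: "mvars (1 :: ('x, 'k::comm_ring_1) mpoly) = {}"
  by (auto simp: mvars_def)

lemma poly_ring_simps [simp]:
  "carrier (poly_ring X) = {p. mvars p \<subseteq> X}"
  "mult (poly_ring X) = (*)" "one (poly_ring X) = 1"
  "zero (poly_ring X) = 0" "add (poly_ring X) = (+)"
  by (simp_all add: poly_ring_def)

lemma cring_poly_ring: "cring (poly_ring X :: ('x, 'k::comm_ring_1) mpoly ring)"
proof (intro cringI abelian_groupI comm_monoidI)
  fix p :: "('x, 'k) mpoly" assume "p \<in> carrier (poly_ring X)"
  then show "\<exists>q\<in>carrier (poly_ring X). q \<oplus>\<^bsub>poly_ring X\<^esub> p = \<zero>\<^bsub>poly_ring X\<^esub>"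
    by (intro bexI[of _ "- p"]) (auto simp: mvars_uminus)
qed (auto simp: mvars_one mvars_def[of 0] algebra_simps dest: mvars_add mvars_mult
      intro: mvars_add[THEN subsetD] mvars_mult[THEN subsetD])

lemma poly_ring_minus:
  assumes "mvars p \<subseteq> X" "mvars q \<subseteq> X"
  shows "p \<ominus>\<^bsub>poly_ring X\<^esub> q = p - (q :: ('x, 'k::comm_ring_1) mpoly)"
proof -
  interpret cring "poly_ring X :: ('x, 'k) mpoly ring" by (rule cring_poly_ring)
  have "\<ominus>\<^bsub>poly_ring X\<^esub> q = - q"
    using assms by (intro minus_equality) (auto simp: mvars_uminus)
  then show ?thesis by (simp add: a_minus_def)
qed

lemma nat_pow_poly_ring:
  "p [^]\<^bsub>poly_ring X\<^esub> (n::nat) = (p :: ('x, 'k::comm_ring_1) mpoly) ^ n"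
  by (induction n) (simp_all add: mult.commute)

lemma ideal_Ann:
  fixes p :: "('x, 'k::field_char_0) mpoly"
  shows "ideal (Ann X p) (poly_ring X)"
proof -
  interpret cring "poly_ring X :: ('x, 'k) mpoly ring" by (rule cring_poly_ring)
  \<comment> \<open>The condition for the product at \<open>b\<close> is a combination of the
    conditions for \<open>P\<close> at the indices \<open>a + b\<close>, with \<open>a\<close> an
    exponent of \<open>Q\<close>.\<close>
  have mult: "P * Q \<in> Ann X p" if "P \<in> Ann X p" "mvars Q \<subseteq> X" for P Q
  proof -
    have "a + c + b = c + (a + b)" for a b c :: "'x \<Rightarrow>\<^sub>0 nat"
      by (simp only: ac_simps)
    then have "lin_ext (\<lambda>a. deriv_at_0 p (a + b)) (Q * P) = 0" for b
      using that(1) by (simp add: Ann_iff lin_ext_mult lin_ext_zero_fun)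
    then have "lin_ext (\<lambda>a. deriv_at_0 p (a + b)) (P * Q) = 0" for b
      by (simp add: mult.commute)
    then show ?thesis using that by (auto simp: Ann_iff dest: mvars_mult)
  qed
  show ?thesis
  proof (rule idealI[OF ring_axioms])
    have "inv\<^bsub>add_monoid (poly_ring X)\<^esub> P = - P" if "mvars P \<subseteq> X" for P :: "('x, 'k) mpoly"
      using poly_ring_minus[of 0 X P] that by (simp add: a_minus_def a_inv_def mvars_def)
    then show "subgroup (Ann X p) (add_monoid (poly_ring X))"
      by (unfold_locales)
        (auto simp: Ann_iff lin_ext_add lin_ext_uminus mvars_uminus mvars_def[of 0] intro: mvars_add[THEN subsetD])
  qed (use mult in \<open>auto simp: mult.commute\<close>)
qed

section \<open>Homogeneous polynomials\<close>

lemma single_1_eq_iff: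
  "Poly_Mapping.single x (1::nat) = Poly_Mapping.single y 1 \<longleftrightarrow> x = y"
  using keys_single[of x "1::nat"] keys_single[of y "1::nat"] by (metis singleton_inject zero_neq_one)

lemma mdeg_superset:
  assumes "finite A" "Poly_Mapping.keys a \<subseteq> A"
  shows "mdeg a = (\<Sum>x\<in>A. Poly_Mapping.lookup a x)"
  unfolding mdeg_def using assms
  by (intro sum.mono_neutral_left) (auto simp: in_keys_iff)

lemma mdeg_add: "mdeg (a + b) = mdeg a + mdeg b"
proof -
  let ?A = "Poly_Mapping.keys a \<union> Poly_Mapping.keys b"
  have "mdeg (a + b) = (\<Sum>x\<in>?A. Poly_Mapping.lookup (a + b) x)"
    by (intro mdeg_superset keys_add) auto
  also have "\<dots> = (\<Sum>x\<in>?A. Poly_Mapping.lookup a x) + (\<Sum>x\<in>?A. Poly_Mapping.lookup b x)"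
    by (simp add: lookup_add sum.distrib)
  also have "\<dots> = mdeg a + mdeg b"
    by (simp add: mdeg_superset[symmetric])
  finally show ?thesis .
qed

lemma mdeg_single [simp]: "mdeg (Poly_Mapping.single x n) = n"
  by (subst mdeg_superset[of "{x}"]) auto

lemma mdeg_0 [simp]: "mdeg 0 = 0"
  by (simp add: mdeg_def)

lemma mdeg_eq_0_iff: "mdeg a = 0 \<longleftrightarrow> a = 0"
  by (auto simp: mdeg_def in_keys_iff intro: poly_mapping_eqI)

lemma mdeg_eq_1E:
  assumes "mdeg a = 1"
  obtains x where "a = Poly_Mapping.single x 1"
proof -
  have "a \<noteq> 0" using assms by auto
  then obtain x where x: "Poly_Mapping.lookup a x \<noteq> 0"
    by (metis poly_mapping_eqI lookup_zero)
  \<comment> \<open>The subtraction does not truncate, since \<open>x\<close> occurs in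
    \<open>a\<close>; the remaining factor has degree 0.\<close>
  have eq: "a = (a - Poly_Mapping.single x 1) + Poly_Mapping.single x 1"
    using x by (intro poly_mapping_eqI) (auto simp: lookup_add lookup_minus lookup_single when_def)
  from arg_cong[OF this, of mdeg] have "a - Poly_Mapping.single x 1 = 0"
    by (simp add: assms mdeg_add mdeg_eq_0_iff)
  with eq show ?thesis by (intro that[of x]) simp
qed

lemma homogeneous_diff:
  "homogeneous k p \<Longrightarrow> homogeneous k q \<Longrightarrow> homogeneous k (p - q :: ('x, 'k::ab_group_add) mpoly)"
  unfolding homogeneous_def using keys_add[of p "- q"] by auto

lemma homogeneous_mult:
  "homogeneous k p \<Longrightarrow> homogeneous l q \<Longrightarrow> homogeneous (k + l) (p * q :: ('x, 'k::comm_ring_1) mpoly)"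
  unfolding homogeneous_def using keys_mult[of p q] by (fastforce simp: mdeg_add)

lemma homogeneous_single: "homogeneous (mdeg a) (Poly_Mapping.single a c)"
  by (simp add: homogeneous_def)

lemma homogeneous_sum:
  "(\<And>i. i \<in> A \<Longrightarrow> homogeneous k (p i)) \<Longrightarrow> homogeneous k (\<Sum>i\<in>A. p i :: ('x, 'k::comm_ring_1) mpoly)"
  unfolding homogeneous_def using keys_sum[of p A] by blast

lemma homogeneous_power:
  "homogeneous 1 p \<Longrightarrow> homogeneous n (p ^ n :: ('x, 'k::comm_ring_1) mpoly)"
proof (induction n)
  case (Suc n)
  then show ?case using homogeneous_mult[of 1 p n "p ^ n"] by simp
qed (simp add: homogeneous_def)

lemma mvars_sum:
  "(\<And>i. i \<in> A \<Longrightarrow> mvars (p i) \<subseteq> X) \<Longrightarrow> mvars (\<Sum>i\<in>A. p i :: ('x, 'k::comm_ring_1) mpoly) \<subseteq> X"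
  unfolding mvars_subset_iff using keys_sum[of p A] by blast

lemma mvars_diff:
  "mvars p \<subseteq> X \<Longrightarrow> mvars q \<subseteq> X \<Longrightarrow> mvars (p - q :: ('x, 'k::comm_ring_1) mpoly) \<subseteq> X"
  using mvars_add[of p X "- q"] by (simp add: mvars_uminus)

lemma mvars_power: "mvars p \<subseteq> X \<Longrightarrow> mvars (p ^ n :: ('x, 'k::comm_ring_1) mpoly) \<subseteq> X"
  by (induction n) (auto simp: mvars_one dest: mvars_mult)

lemma mvars_single: "Poly_Mapping.keys a \<subseteq> X \<Longrightarrow> mvars (Poly_Mapping.single a c) \<subseteq> X"
  by (auto simp: mvars_def)

lemma lin_ext_homogeneous_0:
  assumes "homogeneous 0 p"
  shows "lin_ext g p = Poly_Mapping.lookup p 0 * g 0"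
  using assms by (intro trans[OF lin_ext_superset[of "{0}"]]) (auto simp: homogeneous_def mdeg_eq_0_iff)

lemma lin_ext_homogeneous_1:
  assumes "homogeneous 1 p" "mvars p \<subseteq> X" "finite X"
  shows "lin_ext g p =
    (\<Sum>x\<in>X. Poly_Mapping.lookup p (Poly_Mapping.single x 1) * g (Poly_Mapping.single x 1))"
proof -
  have "Poly_Mapping.keys p \<subseteq> (\<lambda>x. Poly_Mapping.single x 1) ` X"
  proof
    fix a assume a: "a \<in> Poly_Mapping.keys p"
    then obtain x where "a = Poly_Mapping.single x 1"
      using assms(1) mdeg_eq_1E[of a] by (auto simp: homogeneous_def)
    with a assms(2) show "a \<in> (\<lambda>x. Poly_Mapping.single x 1) ` X"
      by (auto simp: mvars_subset_iff)
  qed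
  then show ?thesis
    using assms(3)
    by (subst lin_ext_superset) (auto simp: sum.reindex inj_on_def single_1_eq_iff simp del: One_nat_def)
qed

section \<open>Powers of the sum of the variables acting on a squarefree form\<close>

text \<open>The exponent of the squarefree monomial with support \<open>S\<close>, for finite
  \<open>S\<close>.\<close>

definition set_exp :: "'x set \<Rightarrow> ('x \<Rightarrow>\<^sub>0 nat)" where
  "set_exp S = (\<Sum>x\<in>S. Poly_Mapping.single x 1)"

lemma lookup_set_exp: "finite S \<Longrightarrow> Poly_Mapping.lookup (set_exp S) x = of_bool (x \<in> S)"
  by (simp add: set_exp_def lookup_sum lookup_single when_def sum.delta)

lemma keys_set_exp: "finite S \<Longrightarrow> Poly_Mapping.keys (set_exp S) = S"
  by (auto simp: in_keys_iff lookup_set_exp)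

lemma mdeg_set_exp: "finite S \<Longrightarrow> mdeg (set_exp S) = card S"
  by (simp add: mdeg_def keys_set_exp lookup_set_exp)

lemma set_exp_insert: "finite S \<Longrightarrow> x \<notin> S \<Longrightarrow> set_exp (insert x S) = Poly_Mapping.single x 1 + set_exp S"
  by (simp add: set_exp_def)

lemma set_exp_empty [simp]: "set_exp {} = 0"
  by (simp add: set_exp_def)

lemma prod_mvar: "finite T \<Longrightarrow> (\<Prod>x\<in>T. mvar x) = Poly_Mapping.single (set_exp T) 1"
  by (induction T rule: finite_induct) (auto simp: mvar_def mult_single set_exp_insert)

lemma lin_ext_mvar: "lin_ext g (mvar x) = g (Poly_Mapping.single x 1)"
  by (simp add: mvar_def)

lemma exp_fact_set_exp: "finite T \<Longrightarrow> exp_fact (set_exp T) = 1"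
  by (simp add: exp_fact_def keys_set_exp lookup_set_exp)

lemma deriv_at_0_sum_prod_mvar:
  assumes "\<And>T. T \<in> B \<Longrightarrow> finite T"
  shows "deriv_at_0 (\<Sum>T\<in>B. \<Prod>e\<in>T. mvar e) a = (\<Sum>T\<in>B. of_bool (a = set_exp T))"
  unfolding deriv_at_0_def lookup_sum sum_distrib_left using assms
  by (intro sum.cong) (auto simp: prod_mvar lookup_single when_def exp_fact_set_exp)

text \<open>The functional reads off the coefficient of the squarefree monomial on
  \<open>T - U\<close>, which counts the orderings of \<open>T - U\<close>. In the induction,
  splitting off one factor of the power chooses a variable \<open>x\<close>, which must lie in
  \<open>T - U\<close> and is then moved into \<open>U\<close>.\<close>

lemma lin_ext_power_sum_mvar:
  assumes "finite X" "T \<subseteq> X" "U \<subseteq> T"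
  shows "lin_ext (\<lambda>a. of_bool (a + set_exp U = set_exp T)) ((\<Sum>x\<in>X. mvar x) ^ card (T - U)) =
    (fact (card (T - U)) :: 'k::field_char_0)"
  using assms(3)
proof (induction "card (T - U)" arbitrary: U)
  case 0
  then have "T = U" using assms finite_subset by fastforce
  then show ?case by (simp flip: single_one)
next
  case (Suc n)
  let ?L = "\<Sum>x\<in>X. mvar x :: ('a, 'k) mpoly"
  have fin: "finite T" "finite U" using assms Suc.prems by (meson finite_subset)+
  have *: "lin_ext (\<lambda>b. of_bool (Poly_Mapping.single x 1 + b + set_exp U = set_exp T)) (?L ^ n) =
      (if x \<in> T - U then fact n else (0::'k))" for x
  proof (cases "x \<in> T - U")
    case True
    have "card (T - insert x U) = n"
      using Suc.hyps(2) True fin by (simp add: Diff_insert[of T x U])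
    moreover have "Poly_Mapping.single x 1 + b + set_exp U = b + set_exp (insert x U)" for b
      using True fin by (simp add: set_exp_insert ac_simps)
    ultimately show ?thesis
      using Suc.hyps(1)[of "insert x U"] True Suc.prems by simp
  next
    case False
    \<comment> \<open>If \<open>x\<close> is not in \<open>T\<close>, its exponent on the right is
      0; if it is in \<open>U\<close>, its exponent on the left is at least 2.\<close>
    have "Poly_Mapping.single x 1 + b + set_exp U \<noteq> set_exp T" for b
    proof
      assume "Poly_Mapping.single x 1 + b + set_exp U = set_exp T"
      from arg_cong[OF this, of "\<lambda>a. Poly_Mapping.lookup a x"] show False
        using False fin by (cases "x \<in> T") (auto simp: lookup_add lookup_set_exp)
    qed
    then show ?thesis using False by (simp add: lin_ext_zero_fun)
  qed
  have "lin_ext (\<lambda>a. of_bool (a + set_exp U = set_exp T)) (?L ^ Suc n) =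
      (\<Sum>x\<in>X. if x \<in> T - U then fact n else 0)"
    by (simp add: lin_ext_mult lin_ext_sum lin_ext_mvar * del: Diff_iff One_nat_def)
  also have "\<dots> = (\<Sum>x\<in>T - U. fact n)"
    using assms by (intro sum.mono_neutral_cong_right) auto
  also have "\<dots> = fact (Suc n)" by (simp flip: Suc.hyps(2))
  finally show ?case using Suc.hyps(2) by simp
qed

text \<open>An abstraction of the spanning trees of a graph with edge set \<open>X\<close>: a
  nonempty family of subsets of one common size \<open>s\<close>, which will be the top degree of
  the algebra.\<close>

locale equicardinal_family =
  fixes X :: "'x set" and B :: "'x set set" and s :: nat
  assumes fin_X: "finite X"
    and mem_subset: "T \<in> B \<Longrightarrow> T \<subseteq> X"
    and card_mem: "T \<in> B \<Longrightarrow> card T = s"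
    and nonempty: "B \<noteq> {}"
begin

definition gen_poly :: "('x, 'k::comm_ring_1) mpoly" where
  "gen_poly = (\<Sum>T\<in>B. \<Prod>e\<in>T. mvar e)"

definition var_sum :: "('x, 'k::comm_ring_1) mpoly" where
  "var_sum = (\<Sum>x\<in>X. mvar x)"

text \<open>The entries of the Hessian matrix of \<open>gen_poly\<close> at the point \<open>(1, \<dots>, 1)\<close>.\<close>

definition pair_count :: "'x \<Rightarrow> 'x \<Rightarrow> nat" where
  "pair_count e f = (if e = f then 0 else card {T\<in>B. e \<in> T \<and> f \<in> T})"

lemma fin_mem: "T \<in> B \<Longrightarrow> finite T"
  using mem_subset fin_X finite_subset by blast

lemma fin_B: "finite B"
  by (rule finite_subset[of _ "Pow X"]) (use mem_subset fin_X in auto)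

lemma deriv_at_0_gen_poly: "deriv_at_0 gen_poly a = (\<Sum>T\<in>B. of_bool (a = set_exp T))"
  unfolding gen_poly_def by (rule deriv_at_0_sum_prod_mvar) (rule fin_mem)

lemma deriv_at_0_gen_poly_eq_0: "mdeg a \<noteq> s \<Longrightarrow> deriv_at_0 gen_poly a = 0"
  unfolding deriv_at_0_gen_poly by (intro sum.neutral) (auto simp: mdeg_set_exp fin_mem card_mem)

lemma deriv_at_0_gen_poly_eq_0': "\<not> Poly_Mapping.keys a \<subseteq> X \<Longrightarrow> deriv_at_0 gen_poly a = 0"
  unfolding deriv_at_0_gen_poly
  by (intro sum.neutral ballI) (metis fin_mem keys_set_exp mem_subset of_bool_eq(1))

text \<open>Each member of \<open>B\<close> containing \<open>U\<close> contributes the factorial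
  from \<open>lin_ext_power_sum_mvar\<close>; any other contributes nothing, as its monomial lacks a
  variable of \<open>U\<close>. The cases used are \<open>U\<close> empty and \<open>U\<close> a
  pair.\<close>

lemma lin_ext_power_var_sum:
  assumes "finite U"
  shows "lin_ext (\<lambda>a. deriv_at_0 gen_poly (a + set_exp U)) (var_sum ^ (s - card U)) =
    (fact (s - card U) * of_nat (card {T\<in>B. U \<subseteq> T}) :: 'k::field_char_0)"
proof -
  have "lin_ext (\<lambda>a. of_bool (a + set_exp U = set_exp T)) (var_sum ^ (s - card U)) =
      (if U \<subseteq> T then fact (s - card U) else (0::'k))" if "T \<in> B" for T
  proof (cases "U \<subseteq> T")
    case True
    then have "card (T - U) = s - card U"
      using assms that by (simp add: card_Diff_subset card_mem)
    then show ?thesis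
      using lin_ext_power_sum_mvar[OF fin_X mem_subset[OF that] True] True
      by (simp add: var_sum_def)
  next
    case False
    then obtain x where x: "x \<in> U" "x \<notin> T" by blast
    have "a + set_exp U \<noteq> set_exp T" for a
    proof
      assume "a + set_exp U = set_exp T"
      from arg_cong[OF this, of "\<lambda>a. Poly_Mapping.lookup a x"] show False
        using x that assms fin_mem by (simp add: lookup_add lookup_set_exp)
    qed
    then show ?thesis using False by (simp add: lin_ext_zero_fun)
  qed
  then have "lin_ext (\<lambda>a. deriv_at_0 gen_poly (a + set_exp U)) (var_sum ^ (s - card U)) =
      (\<Sum>T\<in>B. if U \<subseteq> T then fact (s - card U) else (0::'k))"
    by (simp add: deriv_at_0_gen_poly lin_ext_sum_fun)
  also have "\<dots> = (\<Sum>T\<in>{T\<in>B. U \<subseteq> T}. fact (s - card U))"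
    using fin_B by (intro sum.mono_neutral_cong_right) auto
  finally show ?thesis by (simp add: mult.commute)
qed

text \<open>For distinct \<open>e\<close> and \<open>f\<close> this is the count for
  \<open>U = {e, f}\<close>. For \<open>e = f\<close> both sides vanish because
  \<open>gen_poly\<close> is squarefree.\<close>

lemma lin_ext_power_var_sum_pair:
  "lin_ext (\<lambda>a. deriv_at_0 gen_poly (a + (Poly_Mapping.single e 1 + Poly_Mapping.single f 1)))
     (var_sum ^ (s - 2)) =
    (fact (s - 2) * of_nat (pair_count e f) :: 'k::field_char_0)"
proof (cases "e = f")
  case True
  have "a + (Poly_Mapping.single e 1 + Poly_Mapping.single e 1) \<noteq> set_exp T" if "T \<in> B" for a T
  proof
    assume "a + (Poly_Mapping.single e 1 + Poly_Mapping.single e 1) = set_exp T"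
    from arg_cong[OF this, of "\<lambda>a. Poly_Mapping.lookup a e"] show False
      using that fin_mem by (cases "e \<in> T") (simp_all add: lookup_add lookup_set_exp)
  qed
  then show ?thesis
    using True by (simp add: pair_count_def deriv_at_0_gen_poly lin_ext_zero_fun)
next
  case False
  then show ?thesis
    using lin_ext_power_var_sum[of "{e, f}"] by (simp add: set_exp_insert pair_count_def numeral_2_eq_2)
qed

text \<open>As \<open>gen_poly\<close> is homogeneous of degree \<open>s\<close> in the variables
  \<open>X\<close>, all other conditions hold trivially. For \<open>d = s\<close> only
  \<open>b = 0\<close> is left to test, and for \<open>d = s - 1\<close> with
  \<open>s \<ge> 2\<close> only the single variables.\<close>

lemma Ann_homogeneousI:
  fixes P :: "('x, 'k::field_char_0) mpoly"
  assumes "homogeneous d P" "mvars P \<subseteq> X"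
    and "\<And>b. mdeg b + d = s \<Longrightarrow> Poly_Mapping.keys b \<subseteq> X \<Longrightarrow>
      lin_ext (\<lambda>a. deriv_at_0 gen_poly (a + b)) P = 0"
  shows "P \<in> Ann X gen_poly"
  unfolding Ann_iff
proof (intro conjI allI)
  fix b
  show "lin_ext (\<lambda>a. deriv_at_0 gen_poly (a + b)) P = 0"
  proof (cases "mdeg b + d = s \<and> Poly_Mapping.keys b \<subseteq> X")
    case False
    show ?thesis
    proof (rule lin_ext_zero_fun)
      fix a assume a: "a \<in> Poly_Mapping.keys P"
      have "Poly_Mapping.keys b \<subseteq> Poly_Mapping.keys (a + b)"
        by (auto simp: in_keys_iff lookup_add)
      with a False assms(1) show "deriv_at_0 gen_poly (a + b) = (0::'k)"
        using deriv_at_0_gen_poly_eq_0[of "a + b"] deriv_at_0_gen_poly_eq_0'[of "a + b"]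
        by (auto simp: homogeneous_def mdeg_add add.commute)
    qed
  qed (use assms(3) in auto)
qed (use assms(2) in auto)

section \<open>The Lefschetz maps out of degrees 0 and 1\<close>

lemma homogeneous_var_sum: "homogeneous 1 (var_sum :: ('x, 'k::comm_ring_1) mpoly)"
  unfolding var_sum_def mvar_def
  by (intro homogeneous_sum) (metis homogeneous_single mdeg_single)

lemma mvars_var_sum: "mvars (var_sum :: ('x, 'k::comm_ring_1) mpoly) \<subseteq> X"
  unfolding var_sum_def mvar_def by (intro mvars_sum mvars_single) auto

text \<open>Evaluating the power of \<open>var_sum\<close> innermost leaves a functional on
  \<open>p\<close> whose values on monomials of degree 0 and 1 are the counts found above.\<close>

lemma lin_ext_power_var_sum_mult:
  fixes p :: "('x, 'k::comm_ring_1) mpoly"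
  shows "lin_ext (\<lambda>a. deriv_at_0 gen_poly (a + b)) (var_sum ^ n * p) =
    lin_ext (\<lambda>a. lin_ext (\<lambda>c. deriv_at_0 gen_poly (c + (a + b))) (var_sum ^ n)) p"
proof -
  have "a + c + b = c + (a + b)" for a c :: "'x \<Rightarrow>\<^sub>0 nat"
    by (simp only: ac_simps)
  then show ?thesis
    by (subst mult.commute) (simp add: lin_ext_mult)
qed

lemma lin_ext_var_sum_top:
  assumes "homogeneous 0 p"
  shows "lin_ext (\<lambda>a. deriv_at_0 gen_poly (a + 0)) (var_sum ^ s * p) =
    (Poly_Mapping.lookup p 0 * (fact s * of_nat (card B)) :: 'k::field_char_0)"
  unfolding lin_ext_power_var_sum_mult lin_ext_homogeneous_0[OF assms]
  using lin_ext_power_var_sum[of "{}", where 'k = 'k] by simp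

text \<open>Up to a factorial, the Hessian matrix is applied to the coefficient vector of the linear
  form \<open>p\<close>. Bijectivity out of degree 1 thus becomes a question about a linear
  system.\<close>

lemma lin_ext_var_sum_Hessian:
  assumes "homogeneous 1 p" "mvars p \<subseteq> X"
  shows "lin_ext (\<lambda>a. deriv_at_0 gen_poly (a + Poly_Mapping.single e 1)) (var_sum ^ (s - 2) * p) =
    (fact (s - 2) * (\<Sum>f\<in>X. of_nat (pair_count e f) * Poly_Mapping.lookup p (Poly_Mapping.single f 1))
      :: 'k::field_char_0)"
proof -
  have "pair_count f e = pair_count e f" for f
    by (auto simp: pair_count_def intro: arg_cong[where f = card])
  then show ?thesis
    unfolding lin_ext_power_var_sum_mult lin_ext_homogeneous_1[OF assms fin_X]
    by (simp only: lin_ext_power_var_sum_pair sum_distrib_left ac_simps)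
qed

lemma fact_card_B_nonzero: "(fact s * of_nat (card B) :: 'k::field_char_0) \<noteq> 0"
  using nonempty fin_B by simp

lemma power_var_sum_inj_0:
  fixes p :: "('x, 'k::field_char_0) mpoly"
  assumes "homogeneous 0 p" "var_sum ^ s * p \<in> Ann X gen_poly"
  shows "p = 0"
proof -
  have "Poly_Mapping.lookup p 0 * (fact s * of_nat (card B)) = (0::'k)"
    using assms by (simp only: lin_ext_var_sum_top[symmetric] Ann_iff)
  then have "Poly_Mapping.lookup p 0 = 0"
    using fact_card_B_nonzero[where 'k = 'k] by (simp only: mult_eq_0_iff) blast
  then show ?thesis
    using assms(1)
    by (intro poly_mapping_eqI) (metis homogeneous_def in_keys_iff lookup_zero mdeg_eq_0_iff)
qed

lemma power_var_sum_surj_0: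
  fixes q :: "('x, 'k::field_char_0) mpoly"
  assumes "homogeneous s q" "mvars q \<subseteq> X"
  obtains p where "homogeneous 0 p" "mvars p \<subseteq> X" "var_sum ^ s * p - q \<in> Ann X gen_poly"
proof
  \<comment> \<open>The pairing at \<open>b = 0\<close> is the only condition in degree
    \<open>s\<close>; the constant is chosen so that both polynomials have the same pairing
    there.\<close>
  let ?c = "lin_ext (deriv_at_0 gen_poly) q / (fact s * of_nat (card B))"
  let ?p = "Poly_Mapping.single 0 ?c :: ('x, 'k) mpoly"
  show 1: "homogeneous 0 ?p" "mvars ?p \<subseteq> X"
    using homogeneous_single[of 0 ?c] by (auto intro!: mvars_single)
  show "var_sum ^ s * ?p - q \<in> Ann X gen_poly"
  proof (rule Ann_homogeneousI)
    show "homogeneous s (var_sum ^ s * ?p - q)"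
      using homogeneous_mult[OF homogeneous_power[OF homogeneous_var_sum] 1(1), of s] assms
      by (intro homogeneous_diff) auto
    show "mvars (var_sum ^ s * ?p - q) \<subseteq> X"
      by (intro mvars_diff mvars_mult mvars_power mvars_var_sum 1 assms)
  next
    fix b :: "'x \<Rightarrow>\<^sub>0 nat" assume "mdeg b + s = s"
    then have "b = 0" by (simp add: mdeg_eq_0_iff)
    then show "lin_ext (\<lambda>a. deriv_at_0 gen_poly (a + b)) (var_sum ^ s * ?p - q) = 0"
      using lin_ext_var_sum_top[OF 1(1)] fact_card_B_nonzero[where 'k = 'k]
      by (simp add: lin_ext_diff)
  qed
qed

lemma power_var_sum_inj_1:
  fixes p :: "('x, 'k::field_char_0) mpoly"
  assumes "homogeneous 1 p" "mvars p \<subseteq> X" "var_sum ^ (s - 2) * p \<in> Ann X gen_poly"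
    and inj: "\<And>c :: 'x \<Rightarrow> 'k. (\<And>e. e \<in> X \<Longrightarrow> (\<Sum>f\<in>X. of_nat (pair_count e f) * c f) = 0) \<Longrightarrow>
      \<forall>e\<in>X. c e = 0"
  shows "p = 0"
proof -
  have "fact (s - 2) * (\<Sum>f\<in>X. of_nat (pair_count e f) * Poly_Mapping.lookup p (Poly_Mapping.single f 1)) =
      (0::'k)" for e
    using assms(3) by (simp only: lin_ext_var_sum_Hessian[OF assms(1,2), symmetric] Ann_iff)
  then have *: "\<forall>e\<in>X. Poly_Mapping.lookup p (Poly_Mapping.single e 1) = 0"
    by (intro inj) simp
  show ?thesis
  proof (rule poly_mapping_eqI, rule ccontr)
    fix a assume "Poly_Mapping.lookup p a \<noteq> Poly_Mapping.lookup 0 a"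
    then have a: "a \<in> Poly_Mapping.keys p" by (simp add: in_keys_iff)
    then obtain x where "a = Poly_Mapping.single x 1"
      using assms(1) mdeg_eq_1E[of a] by (auto simp: homogeneous_def)
    moreover from a assms(2) have "Poly_Mapping.keys a \<subseteq> X" by (auto simp: mvars_subset_iff)
    ultimately show False using a * by (auto simp: in_keys_iff[of _ p])
  qed
qed

lemma power_var_sum_surj_1:
  fixes q :: "('x, 'k::field_char_0) mpoly"
  assumes "s \<ge> 2" "homogeneous (s - 1) q" "mvars q \<subseteq> X"
    and surj: "\<And>d :: 'x \<Rightarrow> 'k. \<exists>c. \<forall>e\<in>X. (\<Sum>f\<in>X. of_nat (pair_count e f) * c f) = d e"
  obtains p where "homogeneous 1 p" "mvars p \<subseteq> X" "var_sum ^ (s - 2) * p - q \<in> Ann X gen_poly"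
proof -
  \<comment> \<open>The right-hand side is the pairing of \<open>q\<close> at the variable
    \<open>e\<close>, divided by the factorial that multiplies the Hessian matrix in
    \<open>lin_ext_var_sum_Hessian\<close>.\<close>
  obtain c :: "'x \<Rightarrow> 'k" where c: "\<forall>e\<in>X. (\<Sum>f\<in>X. of_nat (pair_count e f) * c f) =
      lin_ext (\<lambda>a. deriv_at_0 gen_poly (a + Poly_Mapping.single e 1)) q / fact (s - 2)"
    using surj[of "\<lambda>e. lin_ext (\<lambda>a. deriv_at_0 gen_poly (a + Poly_Mapping.single e 1)) q / fact (s - 2)"]
    by blast
  define p where "p = (\<Sum>x\<in>X. Poly_Mapping.single (Poly_Mapping.single x (1::nat)) (c x))"
  have p: "homogeneous 1 p" "mvars p \<subseteq> X"
    unfolding p_def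
    by (intro homogeneous_sum, metis homogeneous_single mdeg_single)
      (intro mvars_sum mvars_single, auto)
  have lookup_p: "Poly_Mapping.lookup p (Poly_Mapping.single f 1) = c f" if "f \<in> X" for f
    using that fin_X by (simp add: p_def lookup_sum lookup_single when_def single_1_eq_iff del: One_nat_def)
  have "var_sum ^ (s - 2) * p - q \<in> Ann X gen_poly"
  proof (rule Ann_homogeneousI)
    show "homogeneous (s - 1) (var_sum ^ (s - 2) * p - q)"
      using homogeneous_mult[OF homogeneous_power[OF homogeneous_var_sum] p(1), of "s - 2"] assms
      by (intro homogeneous_diff) (auto simp: Suc_diff_le numeral_2_eq_2 Suc_diff_Suc)
    show "mvars (var_sum ^ (s - 2) * p - q) \<subseteq> X"
      by (intro mvars_diff mvars_mult mvars_power mvars_var_sum p assms)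
  next
    fix b :: "'x \<Rightarrow>\<^sub>0 nat" assume b: "mdeg b + (s - 1) = s" "Poly_Mapping.keys b \<subseteq> X"
    then obtain e where e: "b = Poly_Mapping.single e 1"
      using \<open>s \<ge> 2\<close> by (auto intro: mdeg_eq_1E[of b])
    then have "e \<in> X" using b by auto
    then show "lin_ext (\<lambda>a. deriv_at_0 gen_poly (a + b)) (var_sum ^ (s - 2) * p - q) = 0"
      using c unfolding e lin_ext_diff lin_ext_var_sum_Hessian[OF p] by (simp add: lookup_p del: One_nat_def)
  qed
  with p that show ?thesis by blast
qed

end

section \<open>The quotient algebra\<close>

lemma graph_class_eq_iff:
  fixes p q :: "('e, 'k::field_char_0) mpoly"
  assumes "mvars p \<subseteq> edges G" "mvars q \<subseteq> edges G"
  shows "graph_class G p = graph_class G q \<longleftrightarrow> p - q \<in> Ann (edges G) (kirchhoff G)"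
  using ring.quotient_eq_iff_same_a_r_cos[OF cring.axioms(1)[OF cring_poly_ring] ideal_Ann, of p "edges G" q]
    assms by (auto simp: graph_class_def poly_ring_minus)

lemma ring_hom_graph_class:
  "ring_hom_ring (poly_ring (edges G) :: ('e, 'k::field_char_0) mpoly ring) (graph_algebra G) (graph_class G)"
proof -
  have "graph_class G = ((+>\<^bsub>poly_ring (edges G)\<^esub>) (Ann (edges G) (kirchhoff G :: ('e, 'k) mpoly)))"
    by (simp add: graph_class_def fun_eq_iff)
  then show ?thesis
    unfolding graph_algebra_def by (simp only: ideal.rcos_ring_hom_ring[OF ideal_Ann])
qed

lemma graph_class_power_mult:
  fixes p q :: "('e, 'k::field_char_0) mpoly"
  assumes "mvars p \<subseteq> edges G" "mvars q \<subseteq> edges G"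
  shows "graph_class G p [^]\<^bsub>graph_algebra G\<^esub> (n::nat) \<otimes>\<^bsub>graph_algebra G\<^esub> graph_class G q =
    graph_class G (p ^ n * q)"
proof -
  interpret ring_hom_ring "poly_ring (edges G) :: ('e, 'k) mpoly ring" "graph_algebra G" "graph_class G"
    by (rule ring_hom_graph_class)
  have "graph_class G p [^]\<^bsub>graph_algebra G\<^esub> n = graph_class G (p ^ n)"
    using hom_nat_pow[of p n] assms by (simp add: nat_pow_poly_ring)
  then show ?thesis
    using hom_mult[of "p ^ n" q] assms by (simp add: mvars_power)
qed

lemma graph_algebra_zero:
  "\<zero>\<^bsub>graph_algebra G\<^esub> = graph_class G (0 :: ('e, 'k::field_char_0) mpoly)"
proof -
  interpret ring_hom_ring "poly_ring (edges G) :: ('e, 'k) mpoly ring" "graph_algebra G" "graph_class G"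
    by (rule ring_hom_graph_class)
  show ?thesis using hom_zero by simp
qed

text \<open>Reduces bijectivity between graded pieces of the quotient to statements about
  representatives. Injectivity is the hypothesis \<open>inj\<close> applied to the difference of two
  representatives.\<close>

lemma bij_betw_graph_gradingI:
  fixes l :: "('e, 'k::field_char_0) mpoly"
  assumes l: "mvars l \<subseteq> edges G" "homogeneous 1 l"
    and inj: "\<And>p. homogeneous k p \<Longrightarrow> mvars p \<subseteq> edges G \<Longrightarrow>
      l ^ n * p \<in> Ann (edges G) (kirchhoff G) \<Longrightarrow> p \<in> Ann (edges G) (kirchhoff G)"
    and surj: "\<And>q. homogeneous (n + k) q \<Longrightarrow> mvars q \<subseteq> edges G \<Longrightarrow>
      \<exists>p. homogeneous k p \<and> mvars p \<subseteq> edges G \<and> l ^ n * p - q \<in> Ann (edges G) (kirchhoff G)"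
  shows "bij_betw (\<lambda>a. graph_class G l [^]\<^bsub>graph_algebra G\<^esub> n \<otimes>\<^bsub>graph_algebra G\<^esub> a)
    (graph_grading G k) (graph_grading G (n + k))"
  unfolding bij_betw_def
proof
  show "inj_on (\<lambda>a. graph_class G l [^]\<^bsub>graph_algebra G\<^esub> n \<otimes>\<^bsub>graph_algebra G\<^esub> a) (graph_grading G k)"
  proof (rule inj_onI, clarsimp simp: graph_grading_def)
    fix p q :: "('e, 'k) mpoly"
    assume pq: "mvars p \<subseteq> edges G" "homogeneous k p" "mvars q \<subseteq> edges G" "homogeneous k q"
    assume "graph_class G l [^]\<^bsub>graph_algebra G\<^esub> n \<otimes>\<^bsub>graph_algebra G\<^esub> graph_class G p =
      graph_class G l [^]\<^bsub>graph_algebra G\<^esub> n \<otimes>\<^bsub>graph_algebra G\<^esub> graph_class G q"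
    then have "l ^ n * (p - q) \<in> Ann (edges G) (kirchhoff G)"
      using pq l by (simp add: graph_class_power_mult graph_class_eq_iff mvars_mult mvars_power right_diff_distrib)
    then show "graph_class G p = graph_class G q"
      using inj[of "p - q"] pq by (simp add: graph_class_eq_iff homogeneous_diff mvars_diff)
  qed
  show "(\<lambda>a. graph_class G l [^]\<^bsub>graph_algebra G\<^esub> n \<otimes>\<^bsub>graph_algebra G\<^esub> a) ` graph_grading G k =
      graph_grading G (n + k)"
  proof (intro subset_antisym subsetI)
    fix a assume "a \<in> (\<lambda>a. graph_class G l [^]\<^bsub>graph_algebra G\<^esub> n \<otimes>\<^bsub>graph_algebra G\<^esub> a) ` graph_grading G k"
    then obtain p where "mvars p \<subseteq> edges G" "homogeneous k p" "a = graph_class G (l ^ n * p)"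
      using l by (auto simp: graph_grading_def graph_class_power_mult)
    then show "a \<in> graph_grading G (n + k)"
      using l by (auto simp: graph_grading_def mvars_mult mvars_power homogeneous_mult homogeneous_power)
  next
    fix a :: "('e, 'k) mpoly set" assume "a \<in> graph_grading G (n + k)"
    then obtain q where q: "mvars q \<subseteq> edges G" "homogeneous (n + k) q" "a = graph_class G q"
      by (auto simp: graph_grading_def)
    then obtain p where p: "homogeneous k p" "mvars p \<subseteq> edges G"
        "l ^ n * p - q \<in> Ann (edges G) (kirchhoff G)"
      using surj by blast
    then have "graph_class G l [^]\<^bsub>graph_algebra G\<^esub> n \<otimes>\<^bsub>graph_algebra G\<^esub> graph_class G p = a"
      using q l by (simp add: graph_class_power_mult graph_class_eq_iff mvars_mult mvars_power)
    then show "a \<in> (\<lambda>a. graph_class G l [^]\<^bsub>graph_algebra G\<^esub> n \<otimes>\<^bsub>graph_algebra G\<^esub> a) ` graph_grading G k"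
      using p by (auto simp: graph_grading_def)
  qed
qed

lemma Ann_0: "0 \<in> Ann X (p :: ('x, 'k::field_char_0) mpoly)"
  by (simp add: Ann_iff mvars_def)

section \<open>From the Hessian matrix to the strong Lefschetz property\<close>

context equicardinal_family
begin

text \<open>The hypotheses \<open>inj\<close> and \<open>surj\<close> express invertibility of the
  Hessian matrix at the all-ones point. They are asked for when \<open>s \<ge> 2\<close>, the range
  in which \<open>k = 1\<close> occurs.\<close>

theorem strong_lefschetz_element_var_sum:
  fixes G :: "('v, 'x) ugraph"
  assumes G: "edges G = X" "spanning_trees G = B"
    and s: "s \<le> 4"
    and inj: "\<And>c :: 'x \<Rightarrow> 'k::field_char_0. s \<ge> 2 \<Longrightarrow>
      (\<And>e. e \<in> X \<Longrightarrow> (\<Sum>f\<in>X. of_nat (pair_count e f) * c f) = 0) \<Longrightarrow> \<forall>e\<in>X. c e = 0"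
    and surj: "\<And>d :: 'x \<Rightarrow> 'k. s \<ge> 2 \<Longrightarrow> \<exists>c. \<forall>e\<in>X. (\<Sum>f\<in>X. of_nat (pair_count e f) * c f) = d e"
  shows "strong_lefschetz_element (graph_algebra G :: ('x, 'k) mpoly set ring) (graph_grading G)
    (graph_class G (\<Sum>x\<in>X. mvar x))"
proof -
  let ?A = "graph_algebra G :: ('x, 'k) mpoly set ring"
  have F: "kirchhoff G = (gen_poly :: ('x, 'k) mpoly)"
    by (simp add: kirchhoff_def gen_poly_def G)
  note G' = G(1) F
  have L: "(\<Sum>x\<in>X. mvar x) = (var_sum :: ('x, 'k) mpoly)"
    by (simp add: var_sum_def)
  have gr_mem: "graph_class G p \<in> graph_grading G k"
    if "homogeneous k p" "mvars p \<subseteq> X" for p :: "('x, 'k) mpoly" and k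
    using that by (auto simp: graph_grading_def G)
  have zero: "graph_class G p = \<zero>\<^bsub>?A\<^esub> \<longleftrightarrow> p \<in> Ann X gen_poly" if "mvars p \<subseteq> X"
    for p :: "('x, 'k) mpoly"
    using graph_class_eq_iff[of p G 0] that by (simp add: graph_algebra_zero G' mvars_def[of 0])
  have "graph_grading G s \<noteq> {\<zero>\<^bsub>?A\<^esub>}"
  proof -
    have "homogeneous s (var_sum ^ s :: ('x, 'k) mpoly)" "mvars (var_sum ^ s :: ('x, 'k) mpoly) \<subseteq> X"
      by (intro homogeneous_power homogeneous_var_sum mvars_power mvars_var_sum)+
    \<comment> \<open>Otherwise injectivity in degree 0, applied to the constant 1, would give
      \<open>1 = 0\<close>.\<close>
    moreover have "(var_sum ^ s :: ('x, 'k) mpoly) \<notin> Ann X gen_poly"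
      using power_var_sum_inj_0[of "1 :: ('x, 'k) mpoly"] by (auto simp: homogeneous_def)
    ultimately show ?thesis by (metis gr_mem zero singletonD)
  qed
  moreover have "graph_grading G k = {\<zero>\<^bsub>?A\<^esub>}" if "k > s" for k
  proof -
    \<comment> \<open>No \<open>b\<close> satisfies \<open>mdeg b + k = s\<close>, so the criterion
      is vacuous.\<close>
    have "p \<in> Ann X gen_poly" if "homogeneous k p" "mvars p \<subseteq> X" for p :: "('x, 'k) mpoly"
      using that \<open>k > s\<close> by (intro Ann_homogeneousI) auto
    moreover have "graph_class G (0 :: ('x, 'k) mpoly) \<in> graph_grading G k"
      by (rule gr_mem) (auto simp: homogeneous_def mvars_def)
    ultimately show ?thesis
      using zero unfolding graph_algebra_zero by (auto simp: graph_grading_def G)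
  qed
  moreover have "bij_betw (\<lambda>a. graph_class G var_sum [^]\<^bsub>?A\<^esub> (s - 2 * k) \<otimes>\<^bsub>?A\<^esub> a)
      (graph_grading G k) (graph_grading G (s - k))" if k: "2 * k \<le> s" for k
  proof -
    \<comment> \<open>The value \<open>k = 2\<close> forces \<open>s = 4\<close> and falls under
      \<open>half\<close>, where the exponent is 0 and the map is the identity.\<close>
    consider (0) "k = 0" | (1) "k = 1" | (half) "2 * k = s" using k s by linarith
    note cases_k = this
    have "p \<in> Ann X gen_poly"
      if p: "homogeneous k p" "mvars p \<subseteq> X" "var_sum ^ (s - 2 * k) * p \<in> Ann X gen_poly"
      for p :: "('x, 'k) mpoly"
      using cases_k
    proof cases
      case 0
      then have "p = 0" using power_var_sum_inj_0[of p] p by simp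
      then show ?thesis by (simp add: Ann_0)
    next
      case 1
      then have "p = 0" using power_var_sum_inj_1[OF _ p(2) _ inj] p k by simp
      then show ?thesis by (simp add: Ann_0)
    next
      case half
      then show ?thesis using p by simp
    qed
    moreover have "\<exists>p. homogeneous k p \<and> mvars p \<subseteq> X \<and> var_sum ^ (s - 2 * k) * p - q \<in> Ann X gen_poly"
      if q: "homogeneous (s - 2 * k + k) q" "mvars q \<subseteq> X" for q :: "('x, 'k) mpoly"
      using cases_k
    proof cases
      case 0
      with q have "homogeneous s q" by simp
      from power_var_sum_surj_0[OF this q(2)]
      obtain p where "homogeneous 0 p" "mvars p \<subseteq> X" "var_sum ^ s * p - q \<in> Ann X gen_poly" .
      then show ?thesis using 0 by auto
    next
      case 1
      have "s - 2 * k + k = s - 1" "s \<ge> 2" using k 1 by auto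
      with q have "s \<ge> 2" "homogeneous (s - 1) q" by auto
      from power_var_sum_surj_1[OF this q(2) surj[OF this(1)]]
      obtain p where "homogeneous 1 p" "mvars p \<subseteq> X" "var_sum ^ (s - 2) * p - q \<in> Ann X gen_poly" .
      then show ?thesis using 1 by auto
    next
      case half
      then show ?thesis using q by (intro exI[of _ q]) (simp add: Ann_0)
    qed
    ultimately have "bij_betw (\<lambda>a. graph_class G var_sum [^]\<^bsub>?A\<^esub> (s - 2 * k) \<otimes>\<^bsub>?A\<^esub> a)
      (graph_grading G k) (graph_grading G (s - 2 * k + k))"
      using bij_betw_graph_gradingI[of "var_sum :: ('x, 'k) mpoly" G k "s - 2 * k", unfolded G', OF mvars_var_sum homogeneous_var_sum]
      by blast
    then show ?thesis using k by (simp add: mult_2)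
  qed
  ultimately show ?thesis
    unfolding strong_lefschetz_element_def L
    using gr_mem[OF homogeneous_var_sum mvars_var_sum] by blast
qed

end

section \<open>The Hessian matrix\<close>

text \<open>The matrix is \<open>\<beta> (J - I) - \<gamma> \<tau>\<close> with \<open>J\<close> the all-ones matrix and \<open>\<tau>\<close> the permutation
  matrix of an involution: summing the equations gives the sum of the unknowns, after which the
  system splits into \<open>2 \<times> 2\<close> blocks.\<close>

lemma Hessian_system_solvable:
  fixes \<beta> \<gamma> :: "'k::field_char_0" and \<tau> :: "'x \<Rightarrow> 'x"
  assumes "finite X"
    and \<tau>: "\<And>e. e \<in> X \<Longrightarrow> \<tau> e \<in> X" "\<And>e. e \<in> X \<Longrightarrow> \<tau> (\<tau> e) = e"
    and H: "\<And>e f. e \<in> X \<Longrightarrow> f \<in> X \<Longrightarrow> H e f = \<beta> - \<beta> * of_bool (f = e) - \<gamma> * of_bool (f = \<tau> e)"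
    and ne: "\<beta> * \<beta> \<noteq> \<gamma> * \<gamma>" "of_nat (card X) * \<beta> \<noteq> \<beta> + \<gamma>"
  shows "(\<And>e. e \<in> X \<Longrightarrow> (\<Sum>f\<in>X. H e f * c f) = 0) \<Longrightarrow> \<forall>e\<in>X. c e = 0"
    and "\<exists>c. \<forall>e\<in>X. (\<Sum>f\<in>X. H e f * c f) = d e"
proof -
  have sum_H: "(\<Sum>f\<in>X. H e f * c f) = \<beta> * (\<Sum>f\<in>X. c f) - \<beta> * c e - \<gamma> * c (\<tau> e)"
    if "e \<in> X" for e and c :: "'x \<Rightarrow> 'k"
  proof -
    have "(\<Sum>f\<in>X. H e f * c f) =
        (\<Sum>f\<in>X. \<beta> * c f - (if f = e then \<beta> * c f else 0) - (if f = \<tau> e then \<gamma> * c f else 0))"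
      using that by (intro sum.cong) (auto simp: H left_diff_distrib)
    then show ?thesis
      using that \<tau> assms(1) by (simp add: sum_subtractf sum_distrib_left)
  qed
  have sum_\<tau>: "(\<Sum>f\<in>X. c (\<tau> f)) = (\<Sum>f\<in>X. c f)" for c :: "'x \<Rightarrow> 'k"
    using \<tau> by (intro sum.reindex_bij_witness[of _ \<tau> \<tau>]) auto
  \<comment> \<open>The common column sum of the matrix: adding up all equations multiplies the sum
    of the unknowns by \<open>D\<close>.\<close>
  define D where "D = of_nat (card X) * \<beta> - \<beta> - \<gamma>"
  have D: "D \<noteq> 0" using ne(2) by (auto simp: D_def algebra_simps)
  \<comment> \<open>The determinant of the block with diagonal entries \<beta> and off-diagonal
    entries \<gamma> that couples \<open>c e\<close> and \<open>c (\<tau> e)\<close>.\<close>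
  define E where "E = \<beta> * \<beta> - \<gamma> * \<gamma>"
  have E: "E \<noteq> 0" using ne(1) by (simp add: E_def)
  {
    assume 0: "\<And>e. e \<in> X \<Longrightarrow> (\<Sum>f\<in>X. H e f * c f) = 0"
    have "0 = (\<Sum>e\<in>X. \<beta> * (\<Sum>f\<in>X. c f) - \<beta> * c e - \<gamma> * c (\<tau> e))"
      using 0 by (intro sum.neutral[symmetric]) (auto simp: sum_H)
    also have "\<dots> = D * (\<Sum>f\<in>X. c f)"
      by (simp add: sum_subtractf sum_distrib_left[symmetric] sum_\<tau>) (simp add: D_def algebra_simps)
    finally have S: "(\<Sum>f\<in>X. c f) = 0" using D by simp
    show "\<forall>e\<in>X. c e = 0"
    proof
      fix e assume e: "e \<in> X"
      have "\<beta> * c e + \<gamma> * c (\<tau> e) = 0" "\<beta> * c (\<tau> e) + \<gamma> * c e = 0"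
        using 0[OF e] 0[OF \<tau>(1)[OF e]] sum_H[OF e, of c] sum_H[OF \<tau>(1)[OF e], of c] S e \<tau>
        by (auto simp: algebra_simps eq_neg_iff_add_eq_0)
      moreover have "E * c e = \<beta> * (\<beta> * c e + \<gamma> * c (\<tau> e)) - \<gamma> * (\<beta> * c (\<tau> e) + \<gamma> * c e)"
        by (simp add: E_def algebra_simps)
      ultimately show "c e = 0" using E by simp
    qed
  next
    \<comment> \<open>\<open>S\<close> is the value that the summed equations force on the sum of
      the unknowns. With it the system reads
      \<open>\<beta> * c e + \<gamma> * c (\<tau> e) = d' e\<close>, and \<open>c\<close> is its
      solution by Cramer's rule; that \<open>c\<close> really sums to \<open>S\<close> is then
      checked.\<close>
    define S where "S = (\<Sum>f\<in>X. d f) / D"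
    define d' where "d' e = \<beta> * S - d e" for e
    define c where "c e = (\<beta> * d' e - \<gamma> * d' (\<tau> e)) / E" for e
    have "(\<Sum>f\<in>X. d' f) = of_nat (card X) * \<beta> * S - D * S"
      using D by (simp add: d'_def sum_subtractf S_def)
    also have "\<dots> = (\<beta> + \<gamma>) * S" by (simp add: D_def algebra_simps)
    finally have sum_d': "(\<Sum>f\<in>X. d' f) = (\<beta> + \<gamma>) * S" .
    have "(\<Sum>f\<in>X. c f) = (\<beta> * (\<Sum>f\<in>X. d' f) - \<gamma> * (\<Sum>f\<in>X. d' f)) / E"
      by (simp add: c_def sum_divide_distrib[symmetric] sum_subtractf sum_distrib_left[symmetric] sum_\<tau>)
    also have "\<dots> = E * S / E" unfolding sum_d' by (simp add: E_def algebra_simps)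
    also have "\<dots> = S" using E by simp
    finally have sum_c: "(\<Sum>f\<in>X. c f) = S" .
    have "(\<Sum>f\<in>X. H e f * c f) = d e" if e: "e \<in> X" for e
    proof -
      have "\<beta> * c e + \<gamma> * c (\<tau> e) =
          (\<beta> * (\<beta> * d' e - \<gamma> * d' (\<tau> e)) + \<gamma> * (\<beta> * d' (\<tau> e) - \<gamma> * d' e)) / E"
        using \<tau> e by (simp add: c_def add_divide_distrib)
      also have "\<dots> = E * d' e / E" by (simp add: E_def algebra_simps)
      also have "\<dots> = d' e" using E by simp
      finally show ?thesis
        unfolding sum_H[OF e] sum_c diff_diff_eq by (simp add: d'_def)
    qed
    then show "\<exists>c. \<forall>e\<in>X. (\<Sum>f\<in>X. H e f * c f) = d e" by blast
  }
qed

section \<open>Spanning trees of complete bipartite graphs\<close>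

text \<open>The two classes are arbitrary vertex sets, so that each result can also be applied with
  their roles exchanged.\<close>

locale complete_bipartite_graph =
  fixes G :: "('v, 'e) ugraph" and P Q :: "'v set"
  assumes fin_P: "finite P" and fin_Q: "finite Q"
    and disj: "P \<inter> Q = {}"
    and verts_eq: "verts G = P \<union> Q"
    and bij_ends: "bij_betw (ends G) (edges G) {{u, v} | u v. u \<in> P \<and> v \<in> Q}"
begin

definition edge :: "'v \<Rightarrow> 'v \<Rightarrow> 'e" where
  "edge u v = the_inv_into (edges G) (ends G) {u, v}"

text \<open>The end point in \<open>Q\<close>. For \<open>P\<close> with two elements, spanning
  trees are described by the feet of the edges they omit.\<close>

definition foot :: "'e \<Rightarrow> 'v" where
  "foot e = (THE v. v \<in> Q \<and> v \<in> ends G e)"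

lemma inj_ends: "inj_on (ends G) (edges G)"
  using bij_ends by (simp add: bij_betw_def)

lemma edge:
  assumes "u \<in> P" "v \<in> Q"
  shows edge_mem: "edge u v \<in> edges G" and ends_edge: "ends G (edge u v) = {u, v}"
proof -
  have *: "{u, v} \<in> ends G ` edges G" using bij_ends assms by (auto simp: bij_betw_def)
  show "edge u v \<in> edges G" "ends G (edge u v) = {u, v}"
    unfolding edge_def using the_inv_into_into[OF inj_ends *] f_the_inv_into_f[OF inj_ends *] by auto
qed

lemma foot_edge [simp]: "u \<in> P \<Longrightarrow> v \<in> Q \<Longrightarrow> foot (edge u v) = v"
  unfolding foot_def using disj by (intro the_equality) (auto simp: ends_edge)

lemma edgeE:
  assumes "e \<in> edges G"
  obtains u v where "u \<in> P" "v \<in> Q" "e = edge u v"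
proof -
  obtain u v where uv: "u \<in> P" "v \<in> Q" "ends G e = {u, v}"
    using bij_betw_apply[OF bij_ends assms] by auto
  then have "e = edge u v"
    using inj_onD[OF inj_ends, of e "edge u v"] assms by (simp add: edge)
  with uv that show ?thesis by blast
qed

lemma edge_eq_iff:
  assumes "u \<in> P" "v \<in> Q" "u' \<in> P" "v' \<in> Q"
  shows "edge u v = edge u' v' \<longleftrightarrow> u = u' \<and> v = v'"
proof
  assume "edge u v = edge u' v'"
  then have "{u, v} = {u', v'}" using assms by (metis ends_edge)
  then show "u = u' \<and> v = v'" using assms disj by (auto simp: doubleton_eq_iff)
qed auto

lemma edges_eq: "edges G = (\<lambda>(u, v). edge u v) ` (P \<times> Q)"
  using edge_mem by (auto elim: edgeE)

lemma card_edges: "card (edges G) = card P * card Q"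
  unfolding edges_eq
  by (subst card_image) (auto simp: inj_on_def edge_eq_iff card_cartesian_product)

lemma fin_edges: "finite (edges G)"
  unfolding edges_eq using fin_P fin_Q by simp

lemma foot_mem: "e \<in> edges G \<Longrightarrow> foot e \<in> Q"
  by (auto elim!: edgeE)

lemma ends_inter_Q: "e \<in> edges G \<Longrightarrow> ends G e \<inter> Q = {foot e}"
  using disj by (auto elim!: edgeE simp: ends_edge)

lemma foot_eqI: "e \<in> edges G \<Longrightarrow> v \<in> ends G e \<Longrightarrow> v \<in> Q \<Longrightarrow> foot e = v"
  using ends_inter_Q[of e] by (metis IntI singletonD)

section \<open>Connectedness and cycles\<close>

lemma connects_incident:
  assumes "connects G T" "v \<in> verts G" "w \<in> verts G" "v \<noteq> w"
  obtains e where "e \<in> T" "v \<in> ends G e"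
proof -
  have "(v, w) \<in> (adj_by G T)\<^sup>*" using assms by (auto simp: connects_def)
  then obtain x where "(v, x) \<in> adj_by G T" using assms(4) by (auto elim: converse_rtranclE)
  then show ?thesis using that by (auto simp: adj_by_def)
qed

lemma connects_foot:
  assumes "T \<subseteq> edges G" "connects G T" "P \<noteq> {}" "v \<in> Q"
  obtains e where "e \<in> T" "foot e = v"
proof -
  obtain u where "u \<in> P" using assms by blast
  with assms disj obtain e where "e \<in> T" "v \<in> ends G e"
    by (auto simp: verts_eq intro: connects_incident[of T v u])
  moreover from this have "foot e = v"
    using assms by (intro foot_eqI) auto
  ultimately show ?thesis using that by blast
qed

text \<open>Adjacency is symmetric, so paths to a common root \<open>r\<close> can be reversed and
  joined.\<close>

lemma connectsI:
  assumes "\<And>x. x \<in> verts G \<Longrightarrow> (x, r) \<in> (adj_by G T)\<^sup>*"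
  shows "connects G T"
proof -
  have "sym ((adj_by G T)\<^sup>*)"
    by (intro sym_rtrancl symI) (auto simp: adj_by_def insert_commute)
  then have "(r, x) \<in> (adj_by G T)\<^sup>*" if "x \<in> verts G" for x
    using assms[OF that] by (auto dest: symD)
  then show ?thesis
    unfolding connects_def using assms by (blast intro: rtrancl_trans)
qed

text \<open>A cycle alternates between the classes, which excludes lengths 1 and 3; length 2 would
  need parallel edges. Hence it has length at least 4 and meets \<open>Q\<close> twice, and each
  such vertex is the foot of the two cycle edges next to it.\<close>

lemma cycle_feet:
  assumes cyc: "is_cycle G vs es" and es: "set es \<subseteq> edges G"
  obtains v v' where "v \<noteq> v'" "v \<in> Q" "v' \<in> Q"
    "\<And>w. w \<in> {v, v'} \<Longrightarrow> \<exists>e\<in>set es. \<exists>e'\<in>set es. e \<noteq> e' \<and> foot e = w \<and> foot e' = w"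
proof -
  define n where "n = length vs"
  have len: "length es = n" "length vs = n" "n > 0" and dist: "distinct vs" "distinct es"
    and ends: "\<And>i. i < n \<Longrightarrow> ends G (es ! i) = {vs ! i, vs ! (Suc i mod n)}"
    using cyc by (auto simp: is_cycle_def n_def)
  have mem: "es ! i \<in> edges G" if "i < n" for i using that es len by auto
  have alt: "vs ! (Suc i mod n) \<in> Q \<longleftrightarrow> vs ! i \<notin> Q" if "i < n" for i
    using mem[OF that] ends[OF that] disj
    by (auto elim!: edgeE simp: ends_edge doubleton_eq_iff)
  have two: "\<exists>e\<in>set es. \<exists>e'\<in>set es. e \<noteq> e' \<and> foot e = vs ! i \<and> foot e' = vs ! i"
    if i: "i < n" "vs ! i \<in> Q" and "n > 1" for i
  proof -
    \<comment> \<open>The cyclic predecessor of \<open>i\<close>; edge \<open>j\<close> leads into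
      the vertex at position \<open>i\<close>.\<close>
    define j where "j = (if i = 0 then n - 1 else i - 1)"
    have j: "j < n" "Suc j mod n = i" "j \<noteq> i" using i \<open>n > 1\<close> by (auto simp: j_def)
    have "foot (es ! k) = vs ! i" if "k < n" "vs ! i \<in> ends G (es ! k)" for k
      using mem that i by (intro foot_eqI) auto
    then have "foot (es ! i) = vs ! i" "foot (es ! j) = vs ! i"
      using ends[OF i(1)] ends[OF j(1)] i j by auto
    moreover have "es ! i \<noteq> es ! j" using dist len i j by (simp add: nth_eq_iff_index_eq)
    ultimately show ?thesis using i j len by (metis nth_mem)
  qed
  have "n \<noteq> 1" using alt[of 0] by auto
  moreover have "n \<noteq> 2"
  proof
    assume n: "n = 2"
    then have "es ! 0 = es ! 1"
      using ends[of 0] ends[of 1] mem[of 0] mem[of 1] inj_ends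
      by (auto simp: inj_on_def insert_commute)
    then show False using dist len n by (simp add: nth_eq_iff_index_eq)
  qed
  moreover have "n \<noteq> 3"
    using alt[of 0] alt[of 1] alt[of 2] by (auto simp: numeral_2_eq_2)
  ultimately have n: "n \<ge> 4" using len by linarith
  obtain i j where ij: "i < n" "j < n" "i \<noteq> j" "vs ! i \<in> Q" "vs ! j \<in> Q"
  proof (cases "vs ! 0 \<in> Q")
    case True
    then have "vs ! 2 \<in> Q" using alt[of 0] alt[of 1] n by (simp add: numeral_2_eq_2)
    with True n show ?thesis by (intro that[of 0 2]) auto
  next
    case False
    then have "vs ! 1 \<in> Q" "vs ! 3 \<in> Q"
      using alt[of 0] alt[of 1] alt[of 2] n by (simp_all add: numeral_2_eq_2 numeral_3_eq_3)
    with n show ?thesis by (intro that[of 1 3]) auto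
  qed
  show ?thesis
  proof (rule that[of "vs ! i" "vs ! j"])
    show "vs ! i \<noteq> vs ! j" using ij dist len by (simp add: nth_eq_iff_index_eq)
  qed (use two ij n in auto)
qed

lemma edge_adj:
  assumes "u \<in> P" "v \<in> Q" "edge u v \<in> T"
  shows "(u, v) \<in> adj_by G T" "(v, u) \<in> adj_by G T"
  using assms ends_edge[of u v] by (auto simp: adj_by_def insert_commute intro!: bexI[of _ "edge u v"])

text \<open>Each vertex of \<open>Q\<close> has a single edge, which a connected set must contain.
  Distinct edges have distinct feet, so \<open>cycle_feet\<close> excludes cycles.\<close>

lemma spanning_trees_star:
  assumes P: "P = {p}"
  shows "spanning_trees G = {edges G}"
proof (intro subset_antisym subsetI)
  fix T assume "T \<in> spanning_trees G"
  then have T: "T \<subseteq> edges G" "connects G T" by (auto simp: spanning_trees_def)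
  have "edge p v \<in> T" if v: "v \<in> Q" for v
  proof -
    obtain e where "e \<in> T" "foot e = v"
      by (rule connects_foot[OF T _ v]) (simp add: P)
    then show ?thesis using T P by (auto elim!: edgeE dest!: subsetD)
  qed
  then have "edges G \<subseteq> T" using P by (auto elim!: edgeE)
  with T show "T \<in> {edges G}" by auto
next
  fix T assume "T \<in> {edges G}"
  then have T: "T = edges G" by simp
  have "connects G T"
  proof (rule connectsI[of p])
    fix x assume "x \<in> verts G"
    then consider "x = p" | "x \<in> Q" by (auto simp: verts_eq P)
    then show "(x, p) \<in> (adj_by G T)\<^sup>*"
    proof cases
      case 2
      then show ?thesis
        using edge_adj(2)[of p x T] edge_mem[of p x] P T by auto
    qed simp
  qed
  moreover have "acyclic_edges G T"
    unfolding acyclic_edges_def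
  proof clarify
    fix vs es assume c: "set es \<subseteq> T" "is_cycle G vs es"
    obtain v e e' where "v \<in> Q" "e \<in> T" "e' \<in> T" "e \<noteq> e'" "foot e = v" "foot e' = v"
      by (rule cycle_feet[OF c(2)]) (use c T in blast)+
    then show False using T P by (auto elim!: edgeE)
  qed
  ultimately show "T \<in> spanning_trees G" by (simp add: spanning_trees_def T)
qed

section \<open>Spanning trees when one class has two vertices\<close>

context
  fixes p q
  assumes P: "P = {p, q}" "p \<noteq> q"
begin

lemma edge_cases:
  assumes "e \<in> edges G"
  shows "e = edge p (foot e) \<or> e = edge q (foot e)"
  using assms P by (auto elim!: edgeE)

lemma edge_pq:
  assumes "v \<in> Q"
  shows "edge p v \<in> edges G" "edge q v \<in> edges G" "foot (edge p v) = v" "foot (edge q v) = v"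
    "edge p v \<noteq> edge q v"
  using assms P by (auto simp: edge_mem edge_eq_iff)

text \<open>Shows that an acyclic edge set can join at most one vertex of \<open>Q\<close> to both
  \<open>p\<close> and \<open>q\<close>.\<close>

lemma four_cycle:
  assumes "v \<in> Q" "w \<in> Q" "v \<noteq> w"
  shows "is_cycle G [p, v, q, w] [edge p v, edge q v, edge q w, edge p w]"
proof -
  have "p \<notin> Q" "q \<notin> Q" using P disj by auto
  moreover have "ends G ([edge p v, edge q v, edge q w, edge p w] ! i) =
      {[p, v, q, w] ! i, [p, v, q, w] ! (Suc i mod 4)}" if i: "i < 4" for i
  proof -
    have "ends G (edge p x) = {p, x}" "ends G (edge q x) = {q, x}" if "x \<in> Q" for x
      using that P by (auto simp: ends_edge)
    note e = this[OF assms(1)] this[OF assms(2)]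
    consider "i = 0" | "i = 1" | "i = 2" | "i = 3" using i by linarith
    then show ?thesis
      by cases (simp_all add: e insert_commute)
  qed
  ultimately show ?thesis
    using assms P by (auto simp: is_cycle_def edge_eq_iff)
qed

text \<open>A spanning tree joins exactly one vertex \<open>v\<close> of \<open>Q\<close> to both
  \<open>p\<close> and \<open>q\<close>, and every other one to just one of them. So its complement
  has one edge at each vertex of \<open>Q\<close> other than \<open>v\<close>. Conversely,
  \<open>v\<close> links \<open>p\<close> to \<open>q\<close> and the rest hang on these; a cycle
  would need two vertices of \<open>Q\<close> with both edges present.\<close>

lemma spanning_tree_iff:
  "T \<in> spanning_trees G \<longleftrightarrow>
    T \<subseteq> edges G \<and> inj_on foot (edges G - T) \<and> (\<exists>v\<in>Q. foot ` (edges G - T) = Q - {v})"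
proof (intro iffI conjI)
  assume "T \<in> spanning_trees G"
  then have T: "T \<subseteq> edges G" and con: "connects G T" and acyc: "acyclic_edges G T"
    by (auto simp: spanning_trees_def)
  show "T \<subseteq> edges G" by fact
  have one: "edge p v \<in> T \<or> edge q v \<in> T" if v: "v \<in> Q" for v
  proof -
    obtain e where "e \<in> T" "foot e = v"
      by (rule connects_foot[OF T con _ v]) (simp add: P)
    then show ?thesis using edge_cases[OF subsetD[OF T]] by metis
  qed
  show "inj_on foot (edges G - T)"
  proof (rule inj_onI)
    fix e e' assume "e \<in> edges G - T" "e' \<in> edges G - T" "foot e = foot e'"
    then show "e = e'" using edge_cases[of e] edge_cases[of e'] one[of "foot e"] foot_mem[of e] by auto
  qed
  have "\<exists>v\<in>Q. edge p v \<in> T \<and> edge q v \<in> T"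
  proof (rule ccontr)
    assume none: "\<not> ?thesis"
    \<comment> \<open>If no vertex of \<open>Q\<close> is joined to both, \<open>p\<close> with its
      neighbours is closed under adjacency and misses \<open>q\<close>.\<close>
    define S where "S = insert p {v \<in> Q. edge p v \<in> T}"
    have closed: "y \<in> S" if xy: "(x, y) \<in> adj_by G T" and x: "x \<in> S" for x y
    proof -
      obtain e where e: "e \<in> T" "ends G e = {x, y}" using xy by (auto simp: adj_by_def)
      obtain u v where uv: "u \<in> P" "v \<in> Q" "e = edge u v" using e T by (blast elim: edgeE)
      then have "x = u \<and> y = v \<or> x = v \<and> y = u"
        using e ends_edge[of u v] by (auto simp: doubleton_eq_iff)
      then show ?thesis
        using x uv e none P disj by (auto simp: S_def)
    qed
    have "(p, q) \<in> (adj_by G T)\<^sup>*" using con by (auto simp: connects_def verts_eq P)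
    then have "q \<in> S"
      by (induction rule: rtrancl_induct) (auto intro: closed, simp add: S_def)
    then show False using P disj by (auto simp: S_def)
  qed
  then obtain v where v: "v \<in> Q" "edge p v \<in> T" "edge q v \<in> T" by blast
  have uniq: "w = v" if w: "w \<in> Q" "edge p w \<in> T" "edge q w \<in> T" for w
  proof (rule ccontr)
    assume "w \<noteq> v"
    then have "is_cycle G [p, v, q, w] [edge p v, edge q v, edge q w, edge p w]"
      using v w by (intro four_cycle) auto
    moreover have "set [edge p v, edge q v, edge q w, edge p w] \<subseteq> T" using v w by auto
    ultimately show False using acyc unfolding acyclic_edges_def by blast
  qed
  have "foot ` (edges G - T) = Q - {v}"
  proof (intro subset_antisym subsetI)
    fix w assume "w \<in> foot ` (edges G - T)"
    then obtain e where "e \<in> edges G" "e \<notin> T" "w = foot e" by auto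
    then show "w \<in> Q - {v}" using edge_cases[of e] v foot_mem by auto
  next
    fix w assume "w \<in> Q - {v}"
    then have "edge p w \<in> edges G - T \<or> edge q w \<in> edges G - T" "w \<in> Q"
      using uniq[of w] edge_pq[of w] by auto
    then show "w \<in> foot ` (edges G - T)" using edge_pq[of w] by (auto intro: rev_image_eqI)
  qed
  then show "\<exists>v\<in>Q. foot ` (edges G - T) = Q - {v}" using v by blast
next
  assume "T \<subseteq> edges G \<and> inj_on foot (edges G - T) \<and> (\<exists>v\<in>Q. foot ` (edges G - T) = Q - {v})"
  then obtain v where T: "T \<subseteq> edges G" and inj: "inj_on foot (edges G - T)"
    and v: "v \<in> Q" and img: "foot ` (edges G - T) = Q - {v}" by blast
  have both: "edge p v \<in> T" "edge q v \<in> T" using img edge_pq[OF v] by blast+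
  have one: "edge p w \<in> T \<or> edge q w \<in> T" if w: "w \<in> Q" for w
    using inj edge_pq[OF w] by (metis DiffI inj_onD)
  have qp: "(q, p) \<in> (adj_by G T)\<^sup>*"
    using edge_adj[of q v T] edge_adj[of p v T] both v P
    by (auto intro: rtrancl_trans[OF r_into_rtrancl r_into_rtrancl])
  have "(x, p) \<in> (adj_by G T)\<^sup>*" if x: "x \<in> verts G" for x
  proof -
    consider "x = p" | "x = q" | "x \<in> Q" using x by (auto simp: verts_eq P)
    then show ?thesis
    proof cases
      case 3
      then have "(x, p) \<in> adj_by G T \<or> (x, q) \<in> adj_by G T"
        using one[OF 3] edge_adj[of _ x T] P by auto
      then show ?thesis using qp by (auto intro: converse_rtrancl_into_rtrancl)
    qed (use qp in auto)
  qed
  then have "connects G T" by (rule connectsI)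
  moreover have "acyclic_edges G T"
    unfolding acyclic_edges_def
  proof clarify
    fix vs es assume c: "set es \<subseteq> T" "is_cycle G vs es"
    obtain w w' where w: "w \<noteq> w'" "w \<in> Q" "w' \<in> Q"
      "\<And>x. x \<in> {w, w'} \<Longrightarrow> \<exists>e\<in>set es. \<exists>e'\<in>set es. e \<noteq> e' \<and> foot e = x \<and> foot e' = x"
      by (rule cycle_feet[OF c(2)]) (use c T in blast)+
    have "x = v" if x: "x \<in> {w, w'}" for x
    proof -
      obtain e e' where e: "e \<in> T" "e' \<in> T" "e \<noteq> e'" "foot e = x" "foot e' = x"
        using w(4)[OF x] c by blast
      then have "edge p x \<in> T" "edge q x \<in> T"
        using edge_cases[OF subsetD[OF T]] by metis+
      then have "foot d \<noteq> x" if "d \<in> edges G - T" for d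
        using edge_cases[of d] that by auto
      then have "x \<notin> foot ` (edges G - T)" by blast
      then show ?thesis using img w x by auto
    qed
    then show False using w(1) by auto
  qed
  ultimately show "T \<in> spanning_trees G" using T by (simp add: spanning_trees_def)
qed

end

end

section \<open>The Hessian matrices for a class of one or two vertices\<close>

context complete_bipartite_graph
begin

lemma strong_lefschetz_star:
  assumes "card P = 1" "card Q \<le> 4"
  shows "strong_lefschetz_element (graph_algebra G :: ('e, 'k::field_char_0) mpoly set ring)
    (graph_grading G) (graph_class G (\<Sum>x\<in>edges G. mvar x))"
proof -
  obtain p where P: "P = {p}" using assms(1) by (auto simp: card_1_singleton_iff)
  interpret equicardinal_family "edges G" "{edges G}" "card Q"
    using card_edges by unfold_locales (auto simp: fin_edges P)
  \<comment> \<open>The only tree contains every pair, so the matrix is \<open>J - I\<close>: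
    \<beta> is 1, \<gamma> is 0 and the involution is the identity.\<close>
  have H: "of_nat (pair_count e f) = (1 - 1 * of_bool (f = e) - 0 * of_bool (f = id e) :: 'k)"
    if "e \<in> edges G" "f \<in> edges G" for e f
  proof -
    have "{T. T = edges G \<and> e \<in> T \<and> f \<in> T} = {edges G}" using that by auto
    then show ?thesis by (simp add: pair_count_def)
  qed
  have "of_nat (card (edges G)) * 1 \<noteq> (1 + 0 :: 'k)" if "card Q \<ge> 2"
    using that of_nat_eq_iff[of "card Q" 1, where 'a = 'k] by (simp add: card_edges P)
  note solv = Hessian_system_solvable[OF fin_edges _ _ H _ this]
  show ?thesis
    by (rule strong_lefschetz_element_var_sum[OF refl spanning_trees_star[OF P] assms(2)])
      (rule solv; simp)+
qed

context
  fixes p q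
  assumes P: "P = {p, q}" "p \<noteq> q"
begin

lemma card_compl_spanning_tree:
  assumes "T \<in> spanning_trees G"
  shows "card (edges G - T) = card Q - 1"
proof -
  obtain v where v: "v \<in> Q" "foot ` (edges G - T) = Q - {v}" and inj: "inj_on foot (edges G - T)"
    using assms spanning_tree_iff[OF P, of T] by blast
  have "card (edges G - T) = card (foot ` (edges G - T))" by (simp add: card_image inj)
  then show ?thesis using v fin_Q by simp
qed

lemma card_spanning_tree:
  assumes "T \<in> spanning_trees G" "Q \<noteq> {}"
  shows "card T = card Q + 1"
proof -
  have T: "T \<subseteq> edges G" using assms(1) by (simp add: spanning_trees_def)
  have "card (edges G) = 2 * card Q" using P by (simp add: card_edges)
  moreover have "card Q > 0" using assms(2) fin_Q by (simp add: card_gt_0_iff)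
  moreover have "card (edges G - T) = card (edges G) - card T" "card T \<le> card (edges G)"
    using T fin_edges by (auto simp: card_Diff_subset finite_subset card_mono)
  ultimately show ?thesis using card_compl_spanning_tree[OF assms(1)] by linarith
qed

text \<open>An explicit spanning tree, needed for the nonemptiness in
  \<open>equicardinal_family\<close>.\<close>

lemma diff_image_edge_spanning_tree:
  assumes "v \<in> Q"
  shows "edges G - edge p ` (Q - {v}) \<in> spanning_trees G"
proof -
  have eq: "edges G - (edges G - edge p ` (Q - {v})) = edge p ` (Q - {v})"
    using edge_pq(1)[OF P] by blast
  have "inj_on foot (edge p ` (Q - {v}))" "foot ` edge p ` (Q - {v}) = Q - {v}"
    using edge_pq(3)[OF P] by (auto simp: inj_on_def image_image)
  then show ?thesis
    unfolding spanning_tree_iff[OF P] eq using assms by blast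
qed

lemma equicardinal_spanning_trees:
  "Q \<noteq> {} \<Longrightarrow> equicardinal_family (edges G) (spanning_trees G) (card Q + 1)"
  using diff_image_edge_spanning_tree card_spanning_tree
  by unfold_locales (auto simp: fin_edges spanning_trees_def)

text \<open>Passing to complements is a bijection. A set of \<open>card Q - 1\<close> edges with
  distinct feet automatically misses exactly one vertex of \<open>Q\<close>, so the condition on the
  feet in \<open>spanning_tree_iff\<close> becomes one on the cardinality.\<close>

lemma card_spanning_trees_containing:
  "card {T \<in> spanning_trees G. e \<in> T \<and> f \<in> T} =
   card {C. C \<subseteq> edges G - {e, f} \<and> card C = card Q - 1 \<and> inj_on foot C}"
  if ef: "e \<in> edges G" "f \<in> edges G" and "Q \<noteq> {}"
proof (rule bij_betw_same_card)
  show "bij_betw (\<lambda>T. edges G - T) {T \<in> spanning_trees G. e \<in> T \<and> f \<in> T}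
    {C. C \<subseteq> edges G - {e, f} \<and> card C = card Q - 1 \<and> inj_on foot C}"
  proof (rule bij_betwI[of _ _ _ "\<lambda>T. edges G - T"])
    show "(\<lambda>T. edges G - T) \<in> {T \<in> spanning_trees G. e \<in> T \<and> f \<in> T} \<rightarrow>
        {C. C \<subseteq> edges G - {e, f} \<and> card C = card Q - 1 \<and> inj_on foot C}"
      using card_compl_spanning_tree spanning_tree_iff[OF P] by auto
    show "(\<lambda>T. edges G - T) \<in>
        {C. C \<subseteq> edges G - {e, f} \<and> card C = card Q - 1 \<and> inj_on foot C} \<rightarrow>
        {T \<in> spanning_trees G. e \<in> T \<and> f \<in> T}"
    proof
      fix C assume "C \<in> {C. C \<subseteq> edges G - {e, f} \<and> card C = card Q - 1 \<and> inj_on foot C}"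
      then have C: "C \<subseteq> edges G" "e \<notin> C" "f \<notin> C" "card C = card Q - 1" "inj_on foot C" by auto
      have sub: "foot ` C \<subseteq> Q" using C foot_mem by auto
      have "card (Q - foot ` C) = card Q - card C"
        using C sub fin_Q by (simp add: card_Diff_subset finite_subset card_image)
      also have "\<dots> = 1" using C(4) \<open>Q \<noteq> {}\<close> fin_Q card_gt_0_iff[of Q] by linarith
      finally obtain v where "Q - foot ` C = {v}" by (auto simp: card_1_singleton_iff)
      then have "v \<in> Q" "foot ` C = Q - {v}" using sub by blast+
      moreover have "edges G - (edges G - C) = C" using C by blast
      ultimately show "edges G - C \<in> {T \<in> spanning_trees G. e \<in> T \<and> f \<in> T}"
        using C ef by (auto simp: spanning_tree_iff[OF P])
    qed
  qed (auto simp: spanning_tree_iff[OF P])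
qed

text \<open>The complement is any one of the \<open>4 - 2\<close> edges other than \<open>e\<close>
  and \<open>f\<close>.\<close>

lemma card_spanning_trees_containing_2:
  assumes "card Q = 2" "e \<in> edges G" "f \<in> edges G" "e \<noteq> f"
  shows "card {T \<in> spanning_trees G. e \<in> T \<and> f \<in> T} = 2"
proof -
  have "Q \<noteq> {}" "card Q - 1 = 1" using assms(1) by auto
  then have "card {T \<in> spanning_trees G. e \<in> T \<and> f \<in> T} =
      card {C. C \<subseteq> edges G - {e, f} \<and> card C = 1 \<and> inj_on foot C}"
    using card_spanning_trees_containing[OF assms(2,3)] by metis
  also have "{C. C \<subseteq> edges G - {e, f} \<and> card C = 1 \<and> inj_on foot C} =
      (\<lambda>x. {x}) ` (edges G - {e, f})"
    by (auto simp: card_1_singleton_iff)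
  also have "card \<dots> = card (edges G - {e, f})"
    by (rule card_image) simp
  also have "\<dots> = 2"
    using assms P by (simp add: card_Diff_subset card_edges)
  finally show ?thesis .
qed

text \<open>Of the 6 pairs among the 4 remaining edges, those with a common foot must be discarded.
  There is one for each vertex of \<open>Q\<close> that is a foot of neither \<open>e\<close> nor
  \<open>f\<close>: two if the feet agree and one if they differ.\<close>

lemma card_spanning_trees_containing_3:
  assumes "card Q = 3" "e \<in> edges G" "f \<in> edges G" "e \<noteq> f"
  shows "card {T \<in> spanning_trees G. e \<in> T \<and> f \<in> T} = (if foot e = foot f then 4 else 5)"
proof -
  let ?A = "{C. C \<subseteq> edges G - {e, f} \<and> card C = 2}"
  let ?I = "{C. C \<subseteq> edges G - {e, f} \<and> card C = 2 \<and> inj_on foot C}"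
  let ?N = "(\<lambda>v. {edge p v, edge q v}) ` (Q - {foot e, foot f})"
  note e = edge_pq[OF P]
  have N: "?A - ?I = ?N"
  proof (intro subset_antisym subsetI)
    fix C assume C: "C \<in> ?A - ?I"
    then obtain x y where xy: "x \<in> C" "y \<in> C" "x \<noteq> y" "foot x = foot y"
      by (auto simp: inj_on_def)
    have fC: "finite C" using C by (auto intro: card_ge_0_finite)
    have "card {x, y} = card C" using xy C by auto
    then have "C = {x, y}" using fC xy by (metis card_subset_eq empty_subsetI insert_subset)
    moreover have x: "x \<in> edges G" "y \<in> edges G" using C xy by auto
    ultimately have C': "C = {edge p (foot x), edge q (foot x)}"
      using edge_cases[OF P x(1)] edge_cases[OF P x(2)] xy by (auto simp: insert_commute)
    moreover have "foot x \<noteq> foot e" "foot x \<noteq> foot f"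
      using C C' edge_cases[OF P assms(2)] edge_cases[OF P assms(3)] by auto
    ultimately show "C \<in> ?N" using foot_mem[OF x(1)] by auto
  next
    fix C assume "C \<in> ?N"
    then obtain v where v: "v \<in> Q" "v \<noteq> foot e" "v \<noteq> foot f" "C = {edge p v, edge q v}" by auto
    then show "C \<in> ?A - ?I" using e[OF v(1)] by (auto simp: inj_on_def)
  qed
  have "card ?N = card (Q - {foot e, foot f})"
    using edge_eq_iff P by (intro card_image) (auto simp: inj_on_def doubleton_eq_iff)
  also have "\<dots> = 3 - card {foot e, foot f}"
    using assms foot_mem by (subst card_Diff_subset) auto
  finally have cN: "card ?N = 3 - card {foot e, foot f}" .
  have "card (edges G - {e, f}) = 4"
    using assms P by (simp add: card_Diff_subset card_edges)
  then have "card ?A = 6"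
    using n_subsets[of "edges G - {e, f}" 2] fin_edges by (simp add: choose_two)
  moreover have fA: "finite ?A" using fin_edges by simp
  moreover have "card ?A = card ?I + card (?A - ?I)"
  proof -
    have sub: "?I \<subseteq> ?A" by blast
    show ?thesis
      using card_Diff_subset[OF finite_subset[OF sub fA] sub] card_mono[OF fA sub] by linarith
  qed
  ultimately have "card ?I = 3 + card {foot e, foot f}"
    unfolding N cN by (auto simp: card_insert_if)
  moreover have "card {T \<in> spanning_trees G. e \<in> T \<and> f \<in> T} = card ?I"
  proof -
    have "Q \<noteq> {}" "card Q - 1 = 2" using assms(1) by auto
    then show ?thesis using card_spanning_trees_containing[OF assms(2,3)] by metis
  qed
  ultimately show ?thesis by (auto simp: card_insert_if)
qed

end

lemma strong_lefschetz_card_2: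
  assumes "card P = 2" "card Q = 2 \<or> card Q = 3"
  shows "strong_lefschetz_element (graph_algebra G :: ('e, 'k::field_char_0) mpoly set ring)
    (graph_grading G) (graph_class G (\<Sum>x\<in>edges G. mvar x))"
proof -
  obtain p q where P: "P = {p, q}" "p \<noteq> q" using assms(1) by (auto simp: card_2_iff)
  have "Q \<noteq> {}" using assms(2) by auto
  then interpret equicardinal_family "edges G" "spanning_trees G" "card Q + 1"
    by (rule equicardinal_spanning_trees[OF P])
  have cE: "card (edges G) = 2 * card Q" using assms by (simp add: card_edges)
  show ?thesis
  proof (cases "card Q = 2")
    case True
    \<comment> \<open>With 4 edges, \<beta> equal to 2 and \<gamma> equal to 0, solvability needs
      only that 4 is nonzero and 8 differs from 2.\<close>
    have H: "of_nat (pair_count e f) = (2 - 2 * of_bool (f = e) - 0 * of_bool (f = id e) :: 'k)"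
      if "e \<in> edges G" "f \<in> edges G" for e f
      using card_spanning_trees_containing_2[OF P True that] by (simp add: pair_count_def)
    note solv = Hessian_system_solvable[OF fin_edges _ _ H]
    show ?thesis
      by (rule strong_lefschetz_element_var_sum[OF refl refl])
        (use True in simp, (rule solv; simp add: cE True)+)
  next
    case False
    then have Q: "card Q = 3" using assms by simp
    \<comment> \<open>The involution exchanges the two edges with the same foot.\<close>
    define \<tau> where "\<tau> e = (if e = edge p (foot e) then edge q (foot e) else edge p (foot e))" for e
    have \<tau>_iff: "f = \<tau> e \<longleftrightarrow> f \<noteq> e \<and> foot f = foot e" if "e \<in> edges G" "f \<in> edges G" for e f
      using edge_cases[OF P that(1)] edge_cases[OF P that(2)] edge_pq[OF P foot_mem[OF that(1)]]
      by (auto simp: \<tau>_def)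
    have \<tau>_mem: "\<tau> e \<in> edges G" if "e \<in> edges G" for e
      using edge_pq[OF P foot_mem[OF that]] by (auto simp: \<tau>_def)
    have \<tau>_\<tau>: "\<tau> (\<tau> e) = e" if "e \<in> edges G" for e
      using \<tau>_iff[OF that \<tau>_mem[OF that]] \<tau>_iff[OF \<tau>_mem[OF that] that] by auto
    \<comment> \<open>Here \<beta> is 5 and \<gamma> is 1; with 6 edges, solvability needs that 25
      differs from 1 and 30 from 6.\<close>
    have H: "of_nat (pair_count e f) = (5 - 5 * of_bool (f = e) - 1 * of_bool (f = \<tau> e) :: 'k)"
      if "e \<in> edges G" "f \<in> edges G" for e f
      using card_spanning_trees_containing_3[OF P Q that] \<tau>_iff[OF that]
      by (auto simp: pair_count_def)
    note solv = Hessian_system_solvable[OF fin_edges \<tau>_mem \<tau>_\<tau> H]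
    show ?thesis
      by (rule strong_lefschetz_element_var_sum[OF refl refl])
        (use Q in simp, (rule solv; simp add: cE Q)+)
  qed
qed

lemma complete_bipartite_graph_swap: "complete_bipartite_graph G Q P"
proof
  have "{{u, v} | u v. u \<in> Q \<and> v \<in> P} = {{u, v} | u v. u \<in> P \<and> v \<in> Q}"
    by (auto simp: insert_commute)
  then show "bij_betw (ends G) (edges G) {{u, v} | u v. u \<in> Q \<and> v \<in> P}"
    using bij_ends by simp
qed (use fin_P fin_Q disj verts_eq in auto)

end

section \<open>Transfer to the labelled graphs\<close>

lemma complete_bipartite_graph_complete_bipartite:
  assumes "bij_betw lab {1..m * n} (bipartite_edge_set m n)"
  shows "complete_bipartite_graph (complete_bipartite m n lab) (Inl ` {..<m}) (Inr ` {..<n})"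
proof
  have "bipartite_edge_set m n = {{u, v} | u v. u \<in> Inl ` {..<m} \<and> v \<in> Inr ` {..<n}}"
    by (auto simp: bipartite_edge_set_def)
  then show "bij_betw (ends (complete_bipartite m n lab)) (edges (complete_bipartite m n lab))
      {{u, v} | u v. u \<in> Inl ` {..<m} \<and> v \<in> Inr ` {..<n}}"
    using assms by (simp add: complete_bipartite_def)
qed (auto simp: complete_bipartite_def Plus_def)

theorem theorem4p6:
  fixes m n N :: nat and lab :: "nat \<Rightarrow> (nat + nat) set"
    and G :: "(nat + nat, nat) ugraph"
    and A :: "(nat, 'k::field_char_0) mpoly set ring"
  assumes "m \<ge> 1" and "n \<ge> 1" and "m + n \<le> 5"
    and "N = m * n"
    and "bij_betw lab {1..N} (bipartite_edge_set m n)"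
    and "G = complete_bipartite m n lab"
    and "A = graph_algebra G"
  shows "strong_lefschetz_property A (graph_grading G) \<and>
    strong_lefschetz_element A (graph_grading G) (graph_class G (\<Sum>i=1..N. mvar i))"
proof -
  let ?P = "Inl ` {..<m} :: (nat + nat) set" and ?Q = "Inr ` {..<n} :: (nat + nat) set"
  have PQ: "complete_bipartite_graph G ?P ?Q"
    using assms(4,5,6) complete_bipartite_graph_complete_bipartite by blast
  then have QP: "complete_bipartite_graph G ?Q ?P"
    by (rule complete_bipartite_graph.complete_bipartite_graph_swap)
  have card: "card ?P = m" "card ?Q = n" by (simp_all add: card_image)
  have E: "edges G = {1..N}" using assms(4,6) by (simp add: complete_bipartite_def)
  \<comment> \<open>The smaller class has at most two vertices; if it has two, the other has at most
    three. Exchanging the classes covers both orders.\<close>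
  have "m = 1 \<and> n \<le> 4 \<or> n = 1 \<and> m \<le> 4 \<or> m = 2 \<and> (n = 2 \<or> n = 3) \<or> n = 2 \<and> (m = 2 \<or> m = 3)"
    using assms(1-3) by linarith
  then have "strong_lefschetz_element A (graph_grading G) (graph_class G (\<Sum>i\<in>edges G. mvar i))"
    using complete_bipartite_graph.strong_lefschetz_star[OF PQ, where 'k = 'k]
      complete_bipartite_graph.strong_lefschetz_star[OF QP, where 'k = 'k]
      complete_bipartite_graph.strong_lefschetz_card_2[OF PQ, where 'k = 'k]
      complete_bipartite_graph.strong_lefschetz_card_2[OF QP, where 'k = 'k]
    unfolding card assms(7) using assms(1,2) by blast
  then show ?thesis
    unfolding E strong_lefschetz_property_def by blast
qed

end
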